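(* Let $R$ be an associative ring with $1$, let $n\ge 3$, and let $A,B,C$ be two-sided ideals of $R$. Then $$\big[\big[E(n,A),E(n,B)\big],E(n,C)\big]=\big[E(n,A\circ B),E(n,C)\big].$$
   Context: Rings are associative with $1$, not necessarily commutative. For $1\le i\ne j\le n$ and $c\in R$, the elementary transvection is $t_{ij}(c)=e+c\,e_{ij}\in \mathrm{GL}(n,R)$, where $e$ is the identity matrix and $e_{ij}$ the standard matrix unit. For a two-sided ideal $A$ of $R$, the (unrelative) elementary subgroup of level $A$ is $E(n,A)=\langle t_{ij}(a) : 1\le i\ne j\le n,\ a\in A\rangle\le \mathrm{GL}(n,R)$. For two-sided ideals $A,B$ of $R$, $AB$ is the two-sided ideal additively generated by the products $ab$, $a\in A$, $b\in B$, and $A\circ B=AB+BA$ is the symmetrised product. For elements $x,y$ of a group, $[x,y]=xyx^{-1}y^{-1}$. For subgroups $F,H$ of a group, $[F,H]$ is the subgroup generated by all $[f,h]$ with $f\in F$, $h\in H$. *)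

theory Defs
  imports
    "HOL-Algebra.Ideal_Product"
    "HOL-Algebra.Generated_Groups"
    "Jordan_Normal_Form.Matrix"
begin

text \<open>
  The ring \<open>R\<close> is a ring in the sense of HOL-Algebra: associative, with one, not necessarily
  commutative, and possibly zero. The type \<open>'a mat\<close> only serves as the container for square
  arrays of elements of \<open>R\<close>; the operations below come from \<open>R\<close>, not from type classes.
  Rows and columns are numbered from \<open>0\<close> to \<open>n - 1\<close>.
\<close>

definition mat_monoid :: "('a, 'b) ring_scheme \<Rightarrow> nat \<Rightarrow> 'a mat monoid" where
  "mat_monoid R n =
    \<lparr> carrier = {M \<in> carrier_mat n n. elements_mat M \<subseteq> carrier R},
      monoid.mult = (\<lambda>M N. mat n n (\<lambda>(i, j). \<Oplus>\<^bsub>R\<^esub>k\<in>{..<n}. M $$ (i, k) \<otimes>\<^bsub>R\<^esub> N $$ (k, j))),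
      one = mat n n (\<lambda>(i, j). if i = j then \<one>\<^bsub>R\<^esub> else \<zero>\<^bsub>R\<^esub>) \<rparr>"

definition GL :: "('a, 'b) ring_scheme \<Rightarrow> nat \<Rightarrow> 'a mat monoid" where
  "GL R n = units_of (mat_monoid R n)"

definition transvection :: "('a, 'b) ring_scheme \<Rightarrow> nat \<Rightarrow> nat \<Rightarrow> nat \<Rightarrow> 'a \<Rightarrow> 'a mat" where
  "transvection R n i j c = mat n n (\<lambda>(k, l).
     (if k = l then \<one>\<^bsub>R\<^esub> else \<zero>\<^bsub>R\<^esub>) \<oplus>\<^bsub>R\<^esub> (if k = i \<and> l = j then c else \<zero>\<^bsub>R\<^esub>))"

definition elementary :: "('a, 'b) ring_scheme \<Rightarrow> nat \<Rightarrow> 'a set \<Rightarrow> 'a mat set" where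
  "elementary R n A =
     generate (GL R n) {transvection R n i j a | i j a. i < n \<and> j < n \<and> i \<noteq> j \<and> a \<in> A}"

text \<open>
  The product \<open>ideal_prod\<close> is closed under sums of products only; for two-sided ideals this is
  the additive subgroup generated by the products, and it is a two-sided ideal
  (\<open>ring.ideal_prod_is_ideal\<close>).
\<close>

definition sym_ideal_prod :: "('a, 'b) ring_scheme \<Rightarrow> 'a set \<Rightarrow> 'a set \<Rightarrow> 'a set" where
  "sym_ideal_prod R A B = (A \<cdot>\<^bsub>R\<^esub> B) <+>\<^bsub>R\<^esub> (B \<cdot>\<^bsub>R\<^esub> A)"

definition mixed_commutator :: "('a, 'b) monoid_scheme \<Rightarrow> 'a set \<Rightarrow> 'a set \<Rightarrow> 'a set" where
  "mixed_commutator G F H =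
     generate G {f \<otimes>\<^bsub>G\<^esub> h \<otimes>\<^bsub>G\<^esub> inv\<^bsub>G\<^esub> f \<otimes>\<^bsub>G\<^esub> inv\<^bsub>G\<^esub> h | f h. f \<in> F \<and> h \<in> H}"

end

theory Submission
  imports Defs
begin

text \<open>
  Let \<open>E(n,R,X)\<close> be generated by \<open>z_ij(x,r) = t_ji(r) t_ij(x) t_ji(-r)\<close> with \<open>x \<in> X\<close>, \<open>r \<in> R\<close>, and
  let \<open>y_ij(a,b) = [t_ij(a), t_ji(b)]\<close>. Since \<open>n \<ge> 3\<close>, each \<open>z_ij(x,r)\<close> is a commutator of a
  column and a row vector at a third index; hence \<open>E(n,R,X)\<close> is normal in \<open>E(n,R)\<close> and
  \<open>E(n,R,A \<circ> B)\<close> lies in \<open>[E(n,A), E(n,B)]\<close>. Modulo \<open>E(n,R,A \<circ> B)\<close> the elements \<open>y_ij(a,b)\<close>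
  are central and \<open>y_ij(a,b)\<close> agrees with the inverse of \<open>y_ih(a,-b)\<close>, so that
  \<open>[E(n,A), E(n,B)]\<close> is generated by \<open>E(n,R,A \<circ> B)\<close> and the \<open>y_ij(a,b)\<close> and is normal in
  \<open>E(n,R)\<close>. It then remains to see that \<open>z_ij(x,r)\<close> with \<open>x \<in> A \<circ> B\<close> and \<open>y_ij(a,b)\<close> commute with
  \<open>t_kl(c)\<close>, \<open>c \<in> C\<close>, modulo the normal subgroup \<open>[E(n,A \<circ> B), E(n,C)]\<close>.
\<close>

section \<open>Conjugation and commutators\<close>

context group
begin

definition cnj :: "'a \<Rightarrow> 'a \<Rightarrow> 'a" where
  "cnj g x = g \<otimes> x \<otimes> inv g"

definition cmt :: "'a \<Rightarrow> 'a \<Rightarrow> 'a" where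
  "cmt x y = x \<otimes> y \<otimes> inv x \<otimes> inv y"

lemma cancel_left:
  assumes "x \<in> carrier G" "y \<in> carrier G"
  shows "x \<otimes> (inv x \<otimes> y) = y" "inv x \<otimes> (x \<otimes> y) = y"
  using assms by (simp_all flip: m_assoc)

lemmas word_simps = cnj_def cmt_def m_assoc inv_mult_group cancel_left

lemma cnj_closed [simp]: "g \<in> carrier G \<Longrightarrow> x \<in> carrier G \<Longrightarrow> cnj g x \<in> carrier G"
  by (simp add: cnj_def)

lemma cmt_closed [simp]: "x \<in> carrier G \<Longrightarrow> y \<in> carrier G \<Longrightarrow> cmt x y \<in> carrier G"
  by (simp add: cmt_def)

lemma cnj_one [simp]: "g \<in> carrier G \<Longrightarrow> cnj g \<one> = \<one>"
  by (simp add: cnj_def)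

lemma cnj_mult:
  "g \<in> carrier G \<Longrightarrow> x \<in> carrier G \<Longrightarrow> y \<in> carrier G \<Longrightarrow> cnj g (x \<otimes> y) = cnj g x \<otimes> cnj g y"
  by (simp add: word_simps)

lemma cnj_inv: "g \<in> carrier G \<Longrightarrow> x \<in> carrier G \<Longrightarrow> cnj g (inv x) = inv (cnj g x)"
  by (simp add: word_simps)

lemma cnj_cnj:
  "g \<in> carrier G \<Longrightarrow> h \<in> carrier G \<Longrightarrow> x \<in> carrier G \<Longrightarrow> cnj g (cnj h x) = cnj (g \<otimes> h) x"
  by (simp add: word_simps)

lemma cnj_inv_cnj [simp]:
  "g \<in> carrier G \<Longrightarrow> x \<in> carrier G \<Longrightarrow> cnj g (cnj (inv g) x) = x"
  "g \<in> carrier G \<Longrightarrow> x \<in> carrier G \<Longrightarrow> cnj (inv g) (cnj g x) = x"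
  by (simp_all add: word_simps)

lemma cnj_cmt:
  "g \<in> carrier G \<Longrightarrow> x \<in> carrier G \<Longrightarrow> y \<in> carrier G \<Longrightarrow>
    cnj g (cmt x y) = cmt (cnj g x) (cnj g y)"
  by (simp add: word_simps)

lemma cnj_cnj_distrib:
  "k \<in> carrier G \<Longrightarrow> g \<in> carrier G \<Longrightarrow> x \<in> carrier G \<Longrightarrow>
    cnj k (cnj g x) = cnj (cnj k g) (cnj k x)"
  by (simp add: word_simps)

lemma cnj_eq_cmt_mult: "g \<in> carrier G \<Longrightarrow> x \<in> carrier G \<Longrightarrow> cnj g x = cmt g x \<otimes> x"
  by (simp add: word_simps)

lemma cmt_eq_cnj_mult: "g \<in> carrier G \<Longrightarrow> x \<in> carrier G \<Longrightarrow> cmt g x = cnj g x \<otimes> inv x"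
  by (simp add: word_simps)

lemma inv_cmt: "x \<in> carrier G \<Longrightarrow> y \<in> carrier G \<Longrightarrow> inv (cmt x y) = cmt y x"
  by (simp add: word_simps)

section \<open>Passing from generators to generated subgroups\<close>

lemma cnj_mem_if_cmt_mem:
  assumes "subgroup K G" "x \<in> K" "cmt x g \<in> K" "g \<in> carrier G"
  shows "cnj g x \<in> K"
proof -
  have "x \<in> carrier G" using assms subgroup.mem_carrier by fast
  then have "cnj g x = inv (cmt x g) \<otimes> x" using assms(4) by (simp add: word_simps)
  then show ?thesis using assms by (simp add: subgroup.m_closed subgroup.m_inv_closed)
qed

lemma cmt_swap_mem:
  assumes "subgroup K G" "cmt x y \<in> K" "x \<in> carrier G" "y \<in> carrier G"
  shows "cmt y x \<in> K"
  using inv_cmt[OF assms(3,4)] subgroup.m_inv_closed[OF assms(1,2)] by simp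

lemma cmt_mult_left:
  "x \<in> carrier G \<Longrightarrow> y \<in> carrier G \<Longrightarrow> z \<in> carrier G \<Longrightarrow>
    cmt (x \<otimes> y) z = cnj x (cmt y z) \<otimes> cmt x z"
  by (simp add: word_simps)

lemma cmt_inv_left:
  "x \<in> carrier G \<Longrightarrow> z \<in> carrier G \<Longrightarrow> cmt (inv x) z = cnj (inv x) (inv (cmt x z))"
  by (simp add: word_simps)

lemma cmt_one [simp]:
  "x \<in> carrier G \<Longrightarrow> cmt \<one> x = \<one>" "x \<in> carrier G \<Longrightarrow> cmt x \<one> = \<one>"
  by (simp_all add: cmt_def)

lemma cnj_generate:
  assumes "T \<subseteq> carrier G" "subgroup K G" "g \<in> carrier G" "\<And>x. x \<in> T \<Longrightarrow> cnj g x \<in> K"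
    and "x \<in> generate G T"
  shows "cnj g x \<in> K"
  using assms(5)
proof (induction rule: generate.induct)
  case one then show ?case using assms(2,3) by (simp add: subgroup.one_closed)
next
  case (incl h) then show ?case by (rule assms(4))
next
  case (inv h)
  then have "h \<in> carrier G" using assms(1) by auto
  then show ?case using assms(2-4) inv by (simp add: cnj_inv subgroup.m_inv_closed)
next
  case (eng h1 h2)
  then have "h1 \<in> carrier G" "h2 \<in> carrier G" using generate_in_carrier[OF assms(1)] by auto
  then show ?case using assms(2,3) eng by (simp add: cnj_mult subgroup.m_closed)
qed

text \<open>Here it is the conjugating element that runs through a generated subgroup; an inverted
  generator is again in \<open>S\<close>, so stability under \<open>S\<close> suffices.\<close>

lemma generate_cnj:
  assumes "S \<subseteq> carrier G" "K \<subseteq> carrier G" "\<And>s. s \<in> S \<Longrightarrow> inv s \<in> S"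
    and "\<And>s x. s \<in> S \<Longrightarrow> x \<in> K \<Longrightarrow> cnj s x \<in> K"
    and "g \<in> generate G S" "x \<in> K"
  shows "cnj g x \<in> K"
  using assms(5,6)
proof (induction arbitrary: x rule: generate.induct)
  case one then show ?case using assms(2) by (auto simp: cnj_def)
next
  case (incl h) then show ?case using assms(4) by auto
next
  case (inv h) then show ?case using assms(3,4) by auto
next
  case (eng h1 h2)
  have c: "h1 \<in> carrier G" "h2 \<in> carrier G" "x \<in> carrier G"
    using generate_in_carrier[OF assms(1)] eng assms(2) by auto
  have "cnj h1 (cnj h2 x) \<in> K" using eng by auto
  then show ?case using c by (simp add: cnj_cnj)
qed

lemma cmt_generate_left:
  assumes "S \<subseteq> carrier G" "subgroup K G" "z \<in> carrier G"
    and "\<And>g k. g \<in> generate G S \<Longrightarrow> k \<in> K \<Longrightarrow> cnj g k \<in> K"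
    and "\<And>s. s \<in> S \<Longrightarrow> cmt s z \<in> K"
    and "x \<in> generate G S"
  shows "cmt x z \<in> K"
  using assms(6)
proof (induction rule: generate.induct)
  case one then show ?case using assms(2,3) by (simp add: subgroup.one_closed)
next
  case (incl h) then show ?case by (rule assms(5))
next
  case (inv h)
  then have "h \<in> carrier G" "inv h \<in> generate G S" using assms(1) by (auto intro: generate.inv)
  then show ?case using assms(2-5) inv by (simp add: cmt_inv_left subgroup.m_inv_closed)
next
  case (eng h1 h2)
  then have "h1 \<in> carrier G" "h2 \<in> carrier G" using generate_in_carrier[OF assms(1)] by auto
  then show ?case using assms(2-4) eng by (simp add: cmt_mult_left subgroup.m_closed)
qed

text \<open>Modulo a subgroup normalised by \<open>N\<close>, the expansions
  \<open>cmt_mult_left\<close> and \<open>cmt_inv_left\<close> reduce commutation to generators, one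
  argument after the other.\<close>

lemma cmt_generate:
  assumes S: "S \<subseteq> N" and T: "T \<subseteq> N" and N: "subgroup N G" and K: "subgroup K G"
    and norm: "\<And>g k. g \<in> N \<Longrightarrow> k \<in> K \<Longrightarrow> cnj g k \<in> K"
    and st: "\<And>s t. s \<in> S \<Longrightarrow> t \<in> T \<Longrightarrow> cmt s t \<in> K"
    and x: "x \<in> generate G S" and y: "y \<in> generate G T"
  shows "cmt x y \<in> K"
proof -
  have NG: "N \<subseteq> carrier G" using N by (rule subgroup.subset)
  have gen: "generate G S \<subseteq> N" "generate G T \<subseteq> N"
    using generate_subgroup_incl[OF S N] generate_subgroup_incl[OF T N] .
  note swap = cmt_swap_mem[OF K]
  have SG: "S \<subseteq> carrier G" and TG: "T \<subseteq> carrier G" using S T NG by auto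
  have norm': "cnj g k \<in> K" if "g \<in> generate G S \<or> g \<in> generate G T" "k \<in> K" for g k
    using norm[OF _ that(2)] that(1) gen by blast
  have yG: "y \<in> carrier G" using generate_in_carrier[OF TG y] .
  \<comment> \<open>The second argument is extended first, with \<open>s\<close> fixed;
    \<open>swap\<close> makes it a left argument, to which \<open>cmt_generate_left\<close>
    applies.\<close>
  have sy: "cmt s y \<in> K" if s: "s \<in> S" for s
  proof -
    have sG: "s \<in> carrier G" using s SG by (rule rev_subsetD)
    have "cmt t s \<in> K" if t: "t \<in> T" for t
      using swap[OF st[OF s t] sG subsetD[OF TG t]] .
    then have "cmt y s \<in> K"
      using cmt_generate_left[OF TG K sG norm'[OF disjI2]] y by blast
    then show ?thesis using swap yG sG by blast
  qed
  show ?thesis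
    using cmt_generate_left[OF SG K yG norm'[OF disjI1] sy x] by blast
qed

end

section \<open>Ideals\<close>

lemma (in ring) ideal_zero_closed: "ideal I R \<Longrightarrow> \<zero> \<in> I"
  by (rule additive_subgroup.zero_closed[OF ideal.axioms(1)])

lemma (in ring) ideal_add_closed: "ideal I R \<Longrightarrow> x \<in> I \<Longrightarrow> y \<in> I \<Longrightarrow> x \<oplus> y \<in> I"
  by (rule additive_subgroup.a_closed[OF ideal.axioms(1)])

lemma (in ring) ideal_minus_closed:
  assumes "ideal I R" "x \<in> I"
  shows "\<ominus> x \<in> I"
proof -
  have "x \<in> carrier R" by (rule ideal.Icarr[OF assms])
  then have "\<ominus> x = (\<ominus> \<one>) \<otimes> x" by (simp add: l_minus)
  with ideal.I_l_closed[OF assms, of "\<ominus> \<one>"] show ?thesis by simp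
qed

lemmas (in ring) ideal_closed =
  ideal_zero_closed ideal_add_closed ideal_minus_closed ideal.I_l_closed ideal.I_r_closed

lemma (in ring) sym_ideal_prod_ideal:
  "ideal A R \<Longrightarrow> ideal B R \<Longrightarrow> ideal (sym_ideal_prod R A B) R"
  unfolding sym_ideal_prod_def by (intro add_ideals ideal_prod_is_ideal)

lemma (in ring) mem_sym_ideal_prod_iff:
  "x \<in> sym_ideal_prod R A B \<longleftrightarrow> (\<exists>u \<in> A \<cdot> B. \<exists>v \<in> B \<cdot> A. x = u \<oplus> v)"
  by (simp add: sym_ideal_prod_def set_add_def')

lemma (in ring) sym_ideal_prodI:
  assumes "ideal A R" "ideal B R" "a \<in> A" "b \<in> B"
  shows "a \<otimes> b \<in> sym_ideal_prod R A B" "b \<otimes> a \<in> sym_ideal_prod R A B"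
proof -
  have c: "a \<in> carrier R" "b \<in> carrier R"
    using ideal.Icarr[OF assms(1,3)] ideal.Icarr[OF assms(2,4)] .
  have z: "\<zero> \<in> A \<cdot> B" "\<zero> \<in> B \<cdot> A"
    using assms(1,2) by (auto intro: ideal_zero_closed ideal_prod_is_ideal)
  have p: "a \<otimes> b \<in> A \<cdot> B" "b \<otimes> a \<in> B \<cdot> A" using assms by (auto intro: ideal_prod.prod)
  have "a \<otimes> b = a \<otimes> b \<oplus> \<zero>" "b \<otimes> a = \<zero> \<oplus> b \<otimes> a" using c by auto
  then show "a \<otimes> b \<in> sym_ideal_prod R A B" "b \<otimes> a \<in> sym_ideal_prod R A B"
    unfolding mem_sym_ideal_prod_iff
    using z p by fast+
qed

text \<open>Both summands are additively generated by products, so additive properties need only be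
  checked on products. It is applied to \<open>z_elt i j x r\<close> as a function of
  \<open>x\<close>.\<close>

lemma (in ring) sym_ideal_prod_induct:
  assumes "ideal A R" "ideal B R" "x \<in> sym_ideal_prod R A B"
    and "\<And>a b. a \<in> A \<Longrightarrow> b \<in> B \<Longrightarrow> P (a \<otimes> b)" "\<And>a b. a \<in> A \<Longrightarrow> b \<in> B \<Longrightarrow> P (b \<otimes> a)"
    and "\<And>x y. x \<in> carrier R \<Longrightarrow> y \<in> carrier R \<Longrightarrow> P x \<Longrightarrow> P y \<Longrightarrow> P (x \<oplus> y)"
  shows "P x"
proof -
  obtain u v where uv: "u \<in> A \<cdot> B" "v \<in> B \<cdot> A" "x = u \<oplus> v"
    using assms(3) by (auto simp: mem_sym_ideal_prod_iff)
  have c: "A \<cdot> B \<subseteq> carrier R" "B \<cdot> A \<subseteq> carrier R"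
    using ideal_prod_in_carrier[OF assms(1,2)] ideal_prod_in_carrier[OF assms(2,1)] .
  have "P u" using uv(1)
  proof induction
    case (sum s1 s2)
    then show ?case using c(1) by (intro assms(6)) auto
  qed (rule assms(4))
  moreover have "P v" using uv(2)
  proof induction
    case (sum s1 s2)
    then show ?case using c(2) by (intro assms(6)) auto
  qed (rule assms(5))
  ultimately show ?thesis unfolding uv(3) using uv(1,2) c by (intro assms(6)) auto
qed

section \<open>Groups with Steinberg relations\<close>

text \<open>
  The argument only uses the Steinberg relations between transvections, so it is carried out in an
  arbitrary group with elements \<open>t i j a\<close> satisfying them.
\<close>

locale steinberg = group G + R: ring R
  for G :: "('g, 'c) monoid_scheme" (structure) and R :: "('a, 'b) ring_scheme" +
  fixes n :: nat and t :: "nat \<Rightarrow> nat \<Rightarrow> 'a \<Rightarrow> 'g"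
  assumes rank: "n \<ge> 3"
    and t_closed [simp]: "i < n \<Longrightarrow> j < n \<Longrightarrow> i \<noteq> j \<Longrightarrow> a \<in> carrier R \<Longrightarrow> t i j a \<in> carrier G"
    and t_add: "i < n \<Longrightarrow> j < n \<Longrightarrow> i \<noteq> j \<Longrightarrow> a \<in> carrier R \<Longrightarrow> b \<in> carrier R \<Longrightarrow>
      t i j a \<otimes> t i j b = t i j (a \<oplus>\<^bsub>R\<^esub> b)"
    and t_commute: "i < n \<Longrightarrow> j < n \<Longrightarrow> i \<noteq> j \<Longrightarrow> k < n \<Longrightarrow> l < n \<Longrightarrow> k \<noteq> l \<Longrightarrow>
      j \<noteq> k \<Longrightarrow> i \<noteq> l \<Longrightarrow> a \<in> carrier R \<Longrightarrow> b \<in> carrier R \<Longrightarrow>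
      t i j a \<otimes> t k l b = t k l b \<otimes> t i j a"
    and t_mult: "i < n \<Longrightarrow> j < n \<Longrightarrow> k < n \<Longrightarrow> i \<noteq> j \<Longrightarrow> j \<noteq> k \<Longrightarrow> i \<noteq> k \<Longrightarrow>
      a \<in> carrier R \<Longrightarrow> b \<in> carrier R \<Longrightarrow>
      t i j a \<otimes> t j k b = t i k (a \<otimes>\<^bsub>R\<^esub> b) \<otimes> t j k b \<otimes> t i j a"
begin

abbreviation ix :: "nat \<Rightarrow> nat \<Rightarrow> bool" where
  "ix i j \<equiv> i < n \<and> j < n \<and> i \<noteq> j"

abbreviation ix3 :: "nat \<Rightarrow> nat \<Rightarrow> nat \<Rightarrow> bool" where
  "ix3 i j h \<equiv> i < n \<and> j < n \<and> h < n \<and> i \<noteq> j \<and> i \<noteq> h \<and> j \<noteq> h"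

text \<open>The bound \<open>n \<ge> 3\<close> enters the group-theoretic argument exactly here: a
  third index makes a transvection a commutator of two others.\<close>

lemma third_index: assumes "ix i j" obtains h where "ix3 i j h"
proof -
  have "card {i, j} < card {..<n}"
    using rank by (intro le_less_trans[OF card_insert_le_m1]) auto
  then have "\<not> {..<n} \<subseteq> {i, j}" using card_mono[of "{i, j}" "{..<n}"] by fastforce
  with assms that show ?thesis by auto
qed

lemma t_zero [simp]: assumes "ix i j" shows "t i j \<zero>\<^bsub>R\<^esub> = \<one>"
  using t_add[of i j "\<zero>\<^bsub>R\<^esub>" "\<zero>\<^bsub>R\<^esub>"] assms by simp

lemma t_inv: assumes "ix i j" "a \<in> carrier R" shows "inv (t i j a) = t i j (\<ominus>\<^bsub>R\<^esub> a)"
  using t_add[of i j "\<ominus>\<^bsub>R\<^esub> a" a] assms by (intro inv_equality) (auto simp: R.l_neg)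

lemma cnj_t_commute:
  assumes "ix i j" "ix k l" "j \<noteq> k" "i \<noteq> l" "a \<in> carrier R" "b \<in> carrier R"
  shows "cnj (t i j a) (t k l b) = t k l b"
  using assms t_commute[of i j k l a b] by (simp add: cnj_def m_assoc)

lemma cnj_t_col:
  assumes "ix3 i j h" "a \<in> carrier R" "b \<in> carrier R"
  shows "cnj (t i j a) (t j h b) = t i h (a \<otimes>\<^bsub>R\<^esub> b) \<otimes> t j h b"
  using assms t_mult[of i j h a b] by (simp add: cnj_def m_assoc)

lemma cmt_t:
  assumes "ix3 i j h" "a \<in> carrier R" "b \<in> carrier R"
  shows "cmt (t i j a) (t j h b) = t i h (a \<otimes>\<^bsub>R\<^esub> b)"
  using assms t_mult[of i j h a b] by (simp add: cmt_def m_assoc)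

lemma cnj_t_row:
  assumes "ix3 i j h" "a \<in> carrier R" "b \<in> carrier R"
  shows "cnj (t i j a) (t h i b) = t h j (\<ominus>\<^bsub>R\<^esub> (b \<otimes>\<^bsub>R\<^esub> a)) \<otimes> t h i b"
proof -
  have "cmt (t i j a) (t h i b) = inv (cmt (t h i b) (t i j a))"
    using assms by (simp add: inv_cmt)
  also have "\<dots> = t h j (\<ominus>\<^bsub>R\<^esub> (b \<otimes>\<^bsub>R\<^esub> a))"
    using assms by (simp add: cmt_t t_inv)
  finally show ?thesis using assms by (simp add: cnj_eq_cmt_mult)
qed

section \<open>Column and row vectors at an index outside a block\<close>

definition col_pair :: "nat \<Rightarrow> nat \<Rightarrow> nat \<Rightarrow> 'a \<Rightarrow> 'a \<Rightarrow> 'g" where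
  "col_pair i j l p q = t i l p \<otimes> t j l q"

definition row_pair :: "nat \<Rightarrow> nat \<Rightarrow> nat \<Rightarrow> 'a \<Rightarrow> 'a \<Rightarrow> 'g" where
  "row_pair i j l p q = t l i p \<otimes> t l j q"

lemma col_pair_closed [simp]:
  "ix3 i j l \<Longrightarrow> p \<in> carrier R \<Longrightarrow> q \<in> carrier R \<Longrightarrow> col_pair i j l p q \<in> carrier G"
  by (simp add: col_pair_def)

lemma row_pair_closed [simp]:
  "ix3 i j l \<Longrightarrow> p \<in> carrier R \<Longrightarrow> q \<in> carrier R \<Longrightarrow> row_pair i j l p q \<in> carrier G"
  by (simp add: row_pair_def)

lemma col_pair_swap:
  assumes "ix3 i j l" "p \<in> carrier R" "q \<in> carrier R"
  shows "col_pair i j l p q = col_pair j i l q p"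
  using assms by (simp add: col_pair_def t_commute)

lemma row_pair_swap:
  assumes "ix3 i j l" "p \<in> carrier R" "q \<in> carrier R"
  shows "row_pair i j l p q = row_pair j i l q p"
  using assms by (simp add: row_pair_def t_commute)

lemma col_pair_single:
  assumes "ix3 i j l" "p \<in> carrier R"
  shows "col_pair i j l p \<zero>\<^bsub>R\<^esub> = t i l p" "col_pair i j l \<zero>\<^bsub>R\<^esub> p = t j l p"
  using assms by (simp_all add: col_pair_def)

lemma row_pair_single:
  assumes "ix3 i j l" "p \<in> carrier R"
  shows "row_pair i j l p \<zero>\<^bsub>R\<^esub> = t l i p" "row_pair i j l \<zero>\<^bsub>R\<^esub> p = t l j p"
  using assms by (simp_all add: row_pair_def)

lemma cmt_t_col_pair:
  assumes "ix3 i j l" "a \<in> carrier R" "p \<in> carrier R" "q \<in> carrier R"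
  shows "cmt (t i j a) (col_pair i j l p q) = t i l (a \<otimes>\<^bsub>R\<^esub> q)"
proof -
  have "cnj (t i j a) (col_pair i j l p q) = t i l p \<otimes> (t i l (a \<otimes>\<^bsub>R\<^esub> q) \<otimes> t j l q)"
    using assms by (simp add: col_pair_def cnj_mult cnj_t_commute cnj_t_col)
  also have "\<dots> = t i l (a \<otimes>\<^bsub>R\<^esub> q) \<otimes> col_pair i j l p q"
    using assms t_commute[of i l i l p "a \<otimes>\<^bsub>R\<^esub> q"] by (simp add: col_pair_def flip: m_assoc)
  finally show ?thesis using assms by (simp add: cmt_eq_cnj_mult m_assoc)
qed

lemma cmt_t_row_pair:
  assumes "ix3 i j l" "a \<in> carrier R" "p \<in> carrier R" "q \<in> carrier R"
  shows "cmt (t i j a) (row_pair i j l p q) = t l j (\<ominus>\<^bsub>R\<^esub> (p \<otimes>\<^bsub>R\<^esub> a))"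
proof -
  have "cnj (t i j a) (row_pair i j l p q) = t l j (\<ominus>\<^bsub>R\<^esub> (p \<otimes>\<^bsub>R\<^esub> a)) \<otimes> row_pair i j l p q"
    using assms by (simp add: row_pair_def cnj_mult cnj_t_commute cnj_t_row m_assoc)
  then show ?thesis using assms by (simp add: cmt_eq_cnj_mult m_assoc)
qed

text \<open>A transvection in the block {i,j} acts on the column (p,q) by left multiplication with
  its 2 by 2 matrix, because its commutator with the column is a single entry of column
  \<open>l\<close>.\<close>

lemma cnj_col_pair:
  assumes "ix3 i j l" "a \<in> carrier R" "p \<in> carrier R" "q \<in> carrier R"
  shows "cnj (t i j a) (col_pair i j l p q) = col_pair i j l (p \<oplus>\<^bsub>R\<^esub> a \<otimes>\<^bsub>R\<^esub> q) q"
    and "cnj (t j i a) (col_pair i j l p q) = col_pair i j l p (q \<oplus>\<^bsub>R\<^esub> a \<otimes>\<^bsub>R\<^esub> p)"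
proof -
  have *: "cnj (t i j a) (col_pair i j l p q) = col_pair i j l (p \<oplus>\<^bsub>R\<^esub> a \<otimes>\<^bsub>R\<^esub> q) q"
    if "ix3 i j l" "p \<in> carrier R" "q \<in> carrier R" for i j l p q
    using that assms(2) t_add[of i l "a \<otimes>\<^bsub>R\<^esub> q" p]
    by (simp add: cnj_eq_cmt_mult cmt_t_col_pair) (simp add: col_pair_def R.a_comm flip: m_assoc)
  show "cnj (t i j a) (col_pair i j l p q) = col_pair i j l (p \<oplus>\<^bsub>R\<^esub> a \<otimes>\<^bsub>R\<^esub> q) q"
    using * assms by blast
  show "cnj (t j i a) (col_pair i j l p q) = col_pair i j l p (q \<oplus>\<^bsub>R\<^esub> a \<otimes>\<^bsub>R\<^esub> p)"
    using *[of j i l q p] assms by (simp add: col_pair_swap[of i j l])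
qed

text \<open>On rows, conjugation is right multiplication by the inverse 2 by 2 matrix, whence the
  minus signs.\<close>

lemma cnj_row_pair:
  assumes "ix3 i j l" "a \<in> carrier R" "p \<in> carrier R" "q \<in> carrier R"
  shows "cnj (t i j a) (row_pair i j l p q) = row_pair i j l p (q \<oplus>\<^bsub>R\<^esub> \<ominus>\<^bsub>R\<^esub> (p \<otimes>\<^bsub>R\<^esub> a))"
    and "cnj (t j i a) (row_pair i j l p q) = row_pair i j l (p \<oplus>\<^bsub>R\<^esub> \<ominus>\<^bsub>R\<^esub> (q \<otimes>\<^bsub>R\<^esub> a)) q"
proof -
  have *: "cnj (t j i a) (row_pair i j l p q) = row_pair i j l (p \<oplus>\<^bsub>R\<^esub> \<ominus>\<^bsub>R\<^esub> (q \<otimes>\<^bsub>R\<^esub> a)) q"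
    if "ix3 i j l" "p \<in> carrier R" "q \<in> carrier R" for i j l p q
  proof -
    let ?r = "\<ominus>\<^bsub>R\<^esub> (q \<otimes>\<^bsub>R\<^esub> a)"
    have sw: "row_pair j i l q p = row_pair i j l p q" using row_pair_swap[of i j l p q] that by simp
    have "cnj (t j i a) (row_pair i j l p q) = t l i ?r \<otimes> row_pair i j l p q"
      using cmt_t_row_pair[of j i l a q p] that assms(2) unfolding sw by (simp add: cnj_eq_cmt_mult)
    also have "\<dots> = row_pair i j l (p \<oplus>\<^bsub>R\<^esub> ?r) q"
      using that assms(2) t_add[of l i ?r p] by (simp add: row_pair_def R.a_comm flip: m_assoc)
    finally show ?thesis .
  qed
  show "cnj (t j i a) (row_pair i j l p q) = row_pair i j l (p \<oplus>\<^bsub>R\<^esub> \<ominus>\<^bsub>R\<^esub> (q \<otimes>\<^bsub>R\<^esub> a)) q"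
    using * assms by blast
  show "cnj (t i j a) (row_pair i j l p q) = row_pair i j l p (q \<oplus>\<^bsub>R\<^esub> \<ominus>\<^bsub>R\<^esub> (p \<otimes>\<^bsub>R\<^esub> a))"
    using *[of j i l q p] assms by (simp add: row_pair_swap[of i j l])
qed

definition col_pairs :: "nat \<Rightarrow> nat \<Rightarrow> nat \<Rightarrow> 'a set \<Rightarrow> 'g set" where
  "col_pairs i j l Y = {col_pair i j l p q | p q. p \<in> Y \<and> q \<in> Y}"

definition row_pairs :: "nat \<Rightarrow> nat \<Rightarrow> nat \<Rightarrow> 'a set \<Rightarrow> 'g set" where
  "row_pairs i j l Y = {row_pair i j l p q | p q. p \<in> Y \<and> q \<in> Y}"

lemma col_pairsI: "p \<in> Y \<Longrightarrow> q \<in> Y \<Longrightarrow> col_pair i j l p q \<in> col_pairs i j l Y"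
  unfolding col_pairs_def by blast

lemma col_pairsE:
  assumes "v \<in> col_pairs i j l Y"
  obtains p q where "v = col_pair i j l p q" "p \<in> Y" "q \<in> Y"
  using assms unfolding col_pairs_def by blast

lemma row_pairsI: "p \<in> Y \<Longrightarrow> q \<in> Y \<Longrightarrow> row_pair i j l p q \<in> row_pairs i j l Y"
  unfolding row_pairs_def by blast

lemma row_pairsE:
  assumes "v \<in> row_pairs i j l Y"
  obtains p q where "v = row_pair i j l p q" "p \<in> Y" "q \<in> Y"
  using assms unfolding row_pairs_def by blast

text \<open>The new entries are combinations of the old ones with coefficients in the ring, and an
  ideal absorbs these.\<close>

lemma cnj_pairs:
  assumes "ideal Y R" "ix3 i j l" "a \<in> carrier R" "g = t i j a \<or> g = t j i a"
  shows "v \<in> col_pairs i j l Y \<Longrightarrow> cnj g v \<in> col_pairs i j l Y"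
    and "v \<in> row_pairs i j l Y \<Longrightarrow> cnj g v \<in> row_pairs i j l Y"
proof -
  note [simp] = ideal.Icarr[OF assms(1)]
  show "cnj g v \<in> col_pairs i j l Y" if "v \<in> col_pairs i j l Y"
    using that assms
    by (auto elim!: col_pairsE simp: cnj_col_pair R.ideal_closed intro!: col_pairsI)
  show "cnj g v \<in> row_pairs i j l Y" if "v \<in> row_pairs i j l Y"
    using that assms
    by (auto elim!: row_pairsE simp: cnj_row_pair R.ideal_closed intro!: row_pairsI)
qed

lemma pairs_carrier:
  assumes "Y \<subseteq> carrier R" "ix3 i j l"
  shows "col_pairs i j l Y \<subseteq> carrier G" "row_pairs i j l Y \<subseteq> carrier G"
  using assms by (auto simp: col_pairs_def row_pairs_def subset_iff)

section \<open>Elementary subgroups of a given level\<close>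

definition El :: "'a set \<Rightarrow> 'g set" where
  "El X = generate G {t i j a | i j a. i < n \<and> j < n \<and> i \<noteq> j \<and> a \<in> X}"

lemma t_in_El: "ix i j \<Longrightarrow> a \<in> X \<Longrightarrow> t i j a \<in> El X"
  unfolding El_def by (rule generate.incl) blast

lemma El_gens_carrier:
  "X \<subseteq> carrier R \<Longrightarrow> {t i j a | i j a. i < n \<and> j < n \<and> i \<noteq> j \<and> a \<in> X} \<subseteq> carrier G"
  by auto

lemma El_subgroup: "X \<subseteq> carrier R \<Longrightarrow> subgroup (El X) G"
  unfolding El_def by (rule generate_is_subgroup[OF El_gens_carrier])

lemma El_carrier: "X \<subseteq> carrier R \<Longrightarrow> x \<in> El X \<Longrightarrow> x \<in> carrier G"
  using El_subgroup subgroup.mem_carrier by metis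

lemma El_mono: "X \<subseteq> Y \<Longrightarrow> El X \<subseteq> El Y"
  unfolding El_def by (rule mono_generate) blast

lemma El_incl_subgroup:
  assumes "subgroup K G" "\<And>i j a. ix i j \<Longrightarrow> a \<in> X \<Longrightarrow> t i j a \<in> K"
  shows "El X \<subseteq> K"
  unfolding El_def using assms by (intro generate_subgroup_incl) auto

lemma cnj_El_closed:
  assumes K: "K \<subseteq> carrier G"
    and step: "\<And>k l s x. ix k l \<Longrightarrow> s \<in> carrier R \<Longrightarrow> x \<in> K \<Longrightarrow> cnj (t k l s) x \<in> K"
    and "g \<in> El (carrier R)" "x \<in> K"
  shows "cnj g x \<in> K"
proof (rule generate_cnj[OF El_gens_carrier[OF subset_refl] K _ _ assms(3)[unfolded El_def] assms(4)])
  fix s assume "s \<in> {t i j a |i j a. i < n \<and> j < n \<and> i \<noteq> j \<and> a \<in> carrier R}"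
  then obtain i j a where s: "s = t i j a" "ix i j" "a \<in> carrier R" by blast
  then have "inv s = t i j (\<ominus>\<^bsub>R\<^esub> a)" by (simp add: t_inv)
  with s show "inv s \<in> {t i j a |i j a. i < n \<and> j < n \<and> i \<noteq> j \<and> a \<in> carrier R}" by blast
  show "cnj s x \<in> K" if "x \<in> K" for x using s step that by blast
qed

lemma pairs_El:
  assumes "ideal Y R" "ix3 i j l"
  shows "col_pairs i j l Y \<subseteq> El Y" "row_pairs i j l Y \<subseteq> El Y"
  using assms subgroup.m_closed[OF El_subgroup[OF additive_subgroup.a_subset[OF ideal.axioms(1)]]]
  by (auto simp: col_pairs_def row_pairs_def col_pair_def row_pair_def intro!: t_in_El)

section \<open>Relative elementary subgroups and their normality\<close>

abbreviation z_elt :: "nat \<Rightarrow> nat \<Rightarrow> 'a \<Rightarrow> 'a \<Rightarrow> 'g" where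
  "z_elt i j x r \<equiv> cnj (t j i r) (t i j x)"

text \<open>By \<open>Rel_normal\<close> this is, for an ideal \<open>X\<close>, the normal closure
  of \<open>El X\<close> in \<open>El (carrier R)\<close>; the generators with r = 0 are the
  transvections themselves.\<close>

definition Rel :: "'a set \<Rightarrow> 'g set" where
  "Rel X = generate G {z_elt i j x r | i j x r. i < n \<and> j < n \<and> i \<noteq> j \<and> x \<in> X \<and> r \<in> carrier R}"

lemma Rel_gens_carrier:
  "X \<subseteq> carrier R \<Longrightarrow>
    {z_elt i j x r | i j x r. i < n \<and> j < n \<and> i \<noteq> j \<and> x \<in> X \<and> r \<in> carrier R} \<subseteq> carrier G"
  by auto

lemma ideal_subset: "ideal X R \<Longrightarrow> X \<subseteq> carrier R"
  using ideal.Icarr by fast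

lemma Rel_subgroup: "X \<subseteq> carrier R \<Longrightarrow> subgroup (Rel X) G"
  unfolding Rel_def by (rule generate_is_subgroup[OF Rel_gens_carrier])

lemma z_in_Rel: "ix i j \<Longrightarrow> x \<in> X \<Longrightarrow> r \<in> carrier R \<Longrightarrow> z_elt i j x r \<in> Rel X"
  unfolding Rel_def by (rule generate.incl) blast

lemma t_in_Rel:
  assumes "X \<subseteq> carrier R" "ix i j" "x \<in> X" shows "t i j x \<in> Rel X"
  using z_in_Rel[OF assms(2,3), of "\<zero>\<^bsub>R\<^esub>"] assms by (auto simp: cnj_def subset_iff)

lemma El_sub_Rel: "X \<subseteq> carrier R \<Longrightarrow> El X \<subseteq> Rel X"
  by (intro El_incl_subgroup Rel_subgroup t_in_Rel) auto

text \<open>Conjugation by \<open>t j i r\<close> is pulled out of the commutator: it maps vectors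
  to vectors, and the commutator of \<open>t i j x\<close> with a vector has a single entry, a
  multiple of \<open>x\<close> up to sign.\<close>

lemma cmt_z:
  assumes X: "ideal X R" and ix: "ix3 i j l" and x: "x \<in> X" and r: "r \<in> carrier R"
  shows "v \<in> col_pairs i j l (carrier R) \<Longrightarrow> cmt (z_elt i j x r) v \<in> col_pairs i j l X"
    and "v \<in> row_pairs i j l (carrier R) \<Longrightarrow> cmt (z_elt i j x r) v \<in> row_pairs i j l X"
proof -
  have xR: "x \<in> carrier R" by (rule ideal.Icarr[OF X x])
  let ?g = "t j i r"
  have g: "?g \<in> carrier G" "inv ?g = t j i (\<ominus>\<^bsub>R\<^esub> r)" using ix r by (simp_all add: t_inv)
  have pull: "cmt (z_elt i j x r) v = cnj ?g (cmt (t i j x) (cnj (inv ?g) v))" if "v \<in> carrier G"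
    using that ix r xR g(1) by (simp add: cnj_cmt)
  show "cmt (z_elt i j x r) v \<in> col_pairs i j l X" if v: "v \<in> col_pairs i j l (carrier R)"
  proof -
    have "cnj (inv ?g) v \<in> col_pairs i j l (carrier R)" unfolding g(2)
      by (rule cnj_pairs(1)[OF R.oneideal ix _ disjI2[OF refl] v]) (use r in simp)
    then obtain p q where w: "cnj (inv ?g) v = col_pair i j l p q" "p \<in> carrier R" "q \<in> carrier R"
      by (rule col_pairsE)
    have "cmt (t i j x) (col_pair i j l p q) = col_pair i j l (x \<otimes>\<^bsub>R\<^esub> q) \<zero>\<^bsub>R\<^esub>"
      using ix xR w by (simp add: cmt_t_col_pair col_pair_single)
    also have "\<dots> \<in> col_pairs i j l X" using w x X by (intro col_pairsI) (simp_all add: R.ideal_closed)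
    finally have "cnj ?g (cmt (t i j x) (col_pair i j l p q)) \<in> col_pairs i j l X"
      by (intro cnj_pairs(1)[OF X ix r]) auto
    then show ?thesis using pull pairs_carrier[OF subset_refl ix] v w by auto
  qed
  show "cmt (z_elt i j x r) v \<in> row_pairs i j l X" if v: "v \<in> row_pairs i j l (carrier R)"
  proof -
    have "cnj (inv ?g) v \<in> row_pairs i j l (carrier R)" unfolding g(2)
      by (rule cnj_pairs(2)[OF R.oneideal ix _ disjI2[OF refl] v]) (use r in simp)
    then obtain p q where w: "cnj (inv ?g) v = row_pair i j l p q" "p \<in> carrier R" "q \<in> carrier R"
      by (rule row_pairsE)
    have "cmt (t i j x) (row_pair i j l p q) = row_pair i j l \<zero>\<^bsub>R\<^esub> (\<ominus>\<^bsub>R\<^esub> (p \<otimes>\<^bsub>R\<^esub> x))"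
      using ix xR w by (simp add: cmt_t_row_pair row_pair_single)
    also have "\<dots> \<in> row_pairs i j l X" using w x X by (intro row_pairsI) (simp_all add: R.ideal_closed)
    finally have "cnj ?g (cmt (t i j x) (row_pair i j l p q)) \<in> row_pairs i j l X"
      by (intro cnj_pairs(2)[OF X ix r]) auto
    then show ?thesis using pull pairs_carrier[OF subset_refl ix] v w by auto
  qed
qed

text \<open>The conjugate is the inverse of \<open>cmt (z_elt i j x r) v\<close> times
  \<open>z_elt i j x r\<close>, and that commutator lies in \<open>El X\<close> by
  \<open>cmt_z\<close>.\<close>

lemma cnj_z_in_Rel:
  assumes X: "ideal X R" and ix: "ix3 i j l" and x: "x \<in> X" and r: "r \<in> carrier R"
    and v: "v \<in> col_pairs i j l (carrier R) \<union> row_pairs i j l (carrier R)"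
  shows "cnj v (z_elt i j x r) \<in> Rel X"
proof (rule cnj_mem_if_cmt_mem)
  show "subgroup (Rel X) G" using X by (intro Rel_subgroup ideal_subset)
  show "z_elt i j x r \<in> Rel X" using ix x r by (intro z_in_Rel) auto
  show "cmt (z_elt i j x r) v \<in> Rel X"
    using cmt_z[OF X ix x r, of v] v pairs_El[OF X ix] El_sub_Rel[OF ideal_subset[OF X]] by blast
  show "v \<in> carrier G" using pairs_carrier[OF subset_refl ix] v by blast
qed

text \<open>
  Applied with \<open>z_eq_cmt\<close> below, this settles the one hard case of normality, conjugation of
  \<open>z_elt i j x r\<close> by \<open>t i j s\<close>: a third index \<open>h\<close> turns the conjugate into a commutator of a
  column and a row vector at \<open>h\<close>, which avoids the \<open>2 \<times> 2\<close> block.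
\<close>

lemma cmt_pairs_in_Rel:
  assumes X: "ideal X R" and ix: "ix3 i j h"
    and u: "u \<in> col_pairs i j h X" and v: "v \<in> row_pairs i j h (carrier R)"
  shows "cmt u v \<in> Rel X"
proof -
  note sub = ideal_subset[OF X]
  obtain p q where pq: "u = col_pair i j h p q" "p \<in> X" "q \<in> X" using u by (rule col_pairsE)
  obtain a b where ab: "v = row_pair i j h a b" "a \<in> carrier R" "b \<in> carrier R" using v by (rule row_pairsE)
  have pqR: "p \<in> carrier R" "q \<in> carrier R" using pq sub by auto
  \<comment> \<open>The entries of the row commute, so for each factor of \<open>u\<close> the
    opposite entry of \<open>v\<close> can act first. For \<open>t i h p\<close> this gives
    \<open>z_elt i h p a\<close>, and the remaining \<open>t h j b\<close> is a column vector at
    \<open>j\<close> for the block {i,h}.\<close>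
  have "v = t h j b \<otimes> t h i a" using ab ix row_pair_swap[of i j h a b] by (simp add: row_pair_def)
  then have "cnj v (t i h p) = cnj (t h j b) (z_elt i h p a)"
    using ix ab pqR by (simp add: cnj_cnj)
  also have "\<dots> \<in> Rel X"
    using ix pq ab col_pair_single[of i h j b]
      col_pairsI[of "\<zero>\<^bsub>R\<^esub>" "carrier R" b i h j] by (intro cnj_z_in_Rel[OF X, of i h j]) auto
  finally have 1: "cnj v (t i h p) \<in> Rel X" .
  have "cnj v (t j h q) = cnj (t h i a) (z_elt j h q b)"
    using ix ab pqR by (simp add: row_pair_def cnj_cnj)
  also have "\<dots> \<in> Rel X"
    using ix pq ab col_pair_single[of j h i a]
      col_pairsI[of "\<zero>\<^bsub>R\<^esub>" "carrier R" a j h i] by (intro cnj_z_in_Rel[OF X, of j h i]) auto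
  finally have 2: "cnj v (t j h q) \<in> Rel X" .
  have c: "u \<in> carrier G" "v \<in> carrier G" using ix ab pqR pq by auto
  have S: "subgroup (Rel X) G" by (rule Rel_subgroup[OF sub])
  have "cnj v u = cnj v (t i h p) \<otimes> cnj v (t j h q)"
    using c pq ix pqR by (simp add: col_pair_def cnj_mult)
  with 1 2 have "cnj v u \<in> Rel X" by (simp add: subgroup.m_closed[OF S])
  moreover have "u \<in> Rel X" using u pairs_El[OF X ix] El_sub_Rel[OF sub] by blast
  moreover have "cmt u v = u \<otimes> inv (cnj v u)" using c by (simp add: word_simps)
  ultimately show ?thesis by (simp add: subgroup.m_closed[OF S] subgroup.m_inv_closed[OF S])
qed

text \<open>The transvection with coefficient ab is the commutator of \<open>t i h a\<close> and
  \<open>t h j b\<close>; both conjugations act on this column and this row separately, preserving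
  their ideals. Setting s = 0 gives the generator of \<open>Rel\<close> itself.\<close>

lemma z_eq_cmt:
  assumes "ideal I R" "ideal J R" "ix3 i j h" "a \<in> I" "b \<in> J" "r \<in> carrier R" "s \<in> carrier R"
  shows "\<exists>u \<in> col_pairs i j h I. \<exists>v \<in> row_pairs i j h J. cnj (t i j s) (z_elt i j (a \<otimes>\<^bsub>R\<^esub> b) r) = cmt u v"
proof (intro bexI)
  have R: "a \<in> carrier R" "b \<in> carrier R" using assms ideal.Icarr by fast+
  let ?k = "t i j s" and ?g = "t j i r"
  let ?u = "col_pair i j h a \<zero>\<^bsub>R\<^esub>" and ?v = "row_pair i j h \<zero>\<^bsub>R\<^esub> b"
  have "t i j (a \<otimes>\<^bsub>R\<^esub> b) = cmt ?u ?v"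
    using assms R by (simp add: col_pair_single row_pair_single cmt_t)
  then show "cnj ?k (z_elt i j (a \<otimes>\<^bsub>R\<^esub> b) r) = cmt (cnj ?k (cnj ?g ?u)) (cnj ?k (cnj ?g ?v))"
    using assms R by (simp add: cnj_cmt)
  show "cnj ?k (cnj ?g ?u) \<in> col_pairs i j h I"
    using assms R
    by (intro cnj_pairs(1)[where a = s] cnj_pairs(1)[where a = r]) (auto intro!: col_pairsI R.ideal_closed)
  show "cnj ?k (cnj ?g ?v) \<in> row_pairs i j h J"
    using assms R
    by (intro cnj_pairs(2)[where a = s] cnj_pairs(2)[where a = r]) (auto intro!: row_pairsI R.ideal_closed)
qed

text \<open>The cases are sorted by how {k,l} meets {i,j}. If exactly one index is shared,
  \<open>t k l s\<close> is a column or row vector for the block; for (k,l) = (j,i) the parameter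
  \<open>r\<close> becomes s + r; for disjoint pairs everything commutes.\<close>

lemma cnj_t_z_in_Rel:
  assumes X: "ideal X R" and ix: "ix i j" and kl: "ix k l" and x: "x \<in> X"
    and r: "r \<in> carrier R" and s: "s \<in> carrier R"
  shows "cnj (t k l s) (z_elt i j x r) \<in> Rel X"
proof -
  have xR: "x \<in> carrier R" by (rule ideal.Icarr[OF X x])
  consider "k = i" "l = j" | "k = j" "l = i" | "k = i" "l \<noteq> j" | "k = j" "l \<noteq> i"
    | "l = i" "k \<noteq> j" | "l = j" "k \<noteq> i" | "k \<notin> {i, j}" "l \<notin> {i, j}" by auto
  then show ?thesis
  proof cases
    case 1
    obtain h where h: "ix3 i j h" using third_index[OF ix] .
    \<comment> \<open>Writing \<open>x\<close> as x times one makes the whole ring the second ideal,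
      as \<open>cmt_pairs_in_Rel\<close> requires.\<close>
    obtain u v where "u \<in> col_pairs i j h X" "v \<in> row_pairs i j h (carrier R)"
      "cnj (t i j s) (z_elt i j (x \<otimes>\<^bsub>R\<^esub> \<one>\<^bsub>R\<^esub>) r) = cmt u v"
      using z_eq_cmt[OF X R.oneideal h x R.one_closed r s] by blast
    with 1 show ?thesis using cmt_pairs_in_Rel[OF X h, of u v] xR by simp
  next
    case 2
    then have "cnj (t k l s) (z_elt i j x r) = z_elt i j x (s \<oplus>\<^bsub>R\<^esub> r)"
      using ix r s xR t_add[of j i s r] by (simp add: cnj_cnj)
    then show ?thesis using z_in_Rel[OF ix x, of "s \<oplus>\<^bsub>R\<^esub> r"] r s by simp
  next
    case 3
    then have "t k l s \<in> col_pairs i j l (carrier R)"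
      using col_pair_single(1)[of i j l s] ix kl s col_pairsI[of s "carrier R" "\<zero>\<^bsub>R\<^esub>" i j l] by simp
    with 3 show ?thesis using ix kl by (intro cnj_z_in_Rel[OF X _ x r, of i j l]) auto
  next
    case 4
    then have "t k l s \<in> col_pairs i j l (carrier R)"
      using col_pair_single(2)[of i j l s] ix kl s col_pairsI[of "\<zero>\<^bsub>R\<^esub>" "carrier R" s i j l] by simp
    with 4 show ?thesis using ix kl by (intro cnj_z_in_Rel[OF X _ x r, of i j l]) auto
  next
    case 5
    then have "t k l s \<in> row_pairs i j k (carrier R)"
      using row_pair_single(1)[of i j k s] ix kl s row_pairsI[of s "carrier R" "\<zero>\<^bsub>R\<^esub>" i j k] by simp
    with 5 show ?thesis using ix kl by (intro cnj_z_in_Rel[OF X _ x r, of i j k]) auto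
  next
    case 6
    then have "t k l s \<in> row_pairs i j k (carrier R)"
      using row_pair_single(2)[of i j k s] ix kl s row_pairsI[of "\<zero>\<^bsub>R\<^esub>" "carrier R" s i j k] by simp
    with 6 show ?thesis using ix kl by (intro cnj_z_in_Rel[OF X _ x r, of i j k]) auto
  next
    case 7
    then have "cnj (t k l s) (z_elt i j x r) = z_elt i j x r"
      using ix kl r s xR cnj_t_commute[of k l i j s x] cnj_t_commute[of k l j i s r]
      by (subst cnj_cnj_distrib) auto
    then show ?thesis using z_in_Rel[OF ix x r] by simp
  qed
qed

lemma Rel_normal:
  assumes X: "ideal X R" and "g \<in> El (carrier R)" "w \<in> Rel X"
  shows "cnj g w \<in> Rel X"
proof (rule cnj_El_closed[OF _ _ assms(2,3)])
  have S: "subgroup (Rel X) G" using X by (intro Rel_subgroup ideal_subset)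
  then show "Rel X \<subseteq> carrier G" by (rule subgroup.subset)
  fix k l s w assume k: "ix k l" "s \<in> carrier R" and w: "w \<in> Rel X"
  show "cnj (t k l s) w \<in> Rel X"
    by (rule cnj_generate[OF Rel_gens_carrier[OF ideal_subset[OF X]] S _ _ w[unfolded Rel_def]])
      (use k X in \<open>auto intro: cnj_t_z_in_Rel\<close>)
qed

section \<open>Commutators of opposite transvections\<close>

abbreviation y_elt :: "nat \<Rightarrow> nat \<Rightarrow> 'a \<Rightarrow> 'a \<Rightarrow> 'g" where
  "y_elt i j a b \<equiv> cmt (t i j a) (t j i b)"

abbreviation Mix :: "'a set \<Rightarrow> 'a set \<Rightarrow> 'g set" where
  "Mix X Y \<equiv> mixed_commutator G (El X) (El Y)"

lemma Mix_eq: "Mix X Y = generate G {cmt f h | f h. f \<in> El X \<and> h \<in> El Y}"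
  by (simp add: mixed_commutator_def cmt_def)

lemma cmt_in_Mix: "f \<in> El X \<Longrightarrow> h \<in> El Y \<Longrightarrow> cmt f h \<in> Mix X Y"
  unfolding Mix_eq by (rule generate.incl) blast

lemma Mix_subgroup:
  assumes "X \<subseteq> carrier R" "Y \<subseteq> carrier R" shows "subgroup (Mix X Y) G"
  unfolding Mix_eq using assms by (intro generate_is_subgroup) (auto intro!: cmt_closed intro: El_carrier)

lemma cmt_in_Mix':
  assumes "X \<subseteq> carrier R" "Y \<subseteq> carrier R" "f \<in> El Y" "h \<in> El X"
  shows "cmt f h \<in> Mix X Y"
  using assms by (intro cmt_swap_mem[OF Mix_subgroup cmt_in_Mix]) (auto intro: El_carrier)

text \<open>The four factors of \<open>y_elt i j a b\<close> act in turn on the column (s,0), so the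
  coefficients of \<open>s\<close> form the first column of its 2 by 2 matrix minus the identity.
  They lie in the ideal generated by ab, which is what \<open>cmt_y_t\<close> uses.\<close>

lemma cmt_y_col:
  assumes ix: "ix3 i j l" and R: "a \<in> carrier R" "b \<in> carrier R" "s \<in> carrier R"
  shows "cmt (y_elt i j a b) (t i l s) =
    t i l ((a \<otimes>\<^bsub>R\<^esub> b \<oplus>\<^bsub>R\<^esub> a \<otimes>\<^bsub>R\<^esub> b \<otimes>\<^bsub>R\<^esub> (a \<otimes>\<^bsub>R\<^esub> b)) \<otimes>\<^bsub>R\<^esub> s) \<otimes> t j l (b \<otimes>\<^bsub>R\<^esub> a \<otimes>\<^bsub>R\<^esub> b \<otimes>\<^bsub>R\<^esub> s)"
proof -
  let ?p = "(a \<otimes>\<^bsub>R\<^esub> b \<oplus>\<^bsub>R\<^esub> a \<otimes>\<^bsub>R\<^esub> b \<otimes>\<^bsub>R\<^esub> (a \<otimes>\<^bsub>R\<^esub> b)) \<otimes>\<^bsub>R\<^esub> s"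
  let ?q = "b \<otimes>\<^bsub>R\<^esub> a \<otimes>\<^bsub>R\<^esub> b \<otimes>\<^bsub>R\<^esub> s"
  have "cnj (t j i (\<ominus>\<^bsub>R\<^esub> b)) (t i l s) = col_pair i j l s (\<ominus>\<^bsub>R\<^esub> (b \<otimes>\<^bsub>R\<^esub> s))"
    using cnj_col_pair(2)[of i j l "\<ominus>\<^bsub>R\<^esub> b" s "\<zero>\<^bsub>R\<^esub>"] ix R by (simp add: col_pair_single R.l_minus)
  moreover have "cnj (t i j (\<ominus>\<^bsub>R\<^esub> a)) (col_pair i j l s (\<ominus>\<^bsub>R\<^esub> (b \<otimes>\<^bsub>R\<^esub> s))) =
      col_pair i j l (s \<oplus>\<^bsub>R\<^esub> a \<otimes>\<^bsub>R\<^esub> (b \<otimes>\<^bsub>R\<^esub> s)) (\<ominus>\<^bsub>R\<^esub> (b \<otimes>\<^bsub>R\<^esub> s))"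
    using ix R by (simp add: cnj_col_pair R.l_minus R.r_minus)
  moreover have "\<ominus>\<^bsub>R\<^esub> (b \<otimes>\<^bsub>R\<^esub> s) \<oplus>\<^bsub>R\<^esub> b \<otimes>\<^bsub>R\<^esub> (s \<oplus>\<^bsub>R\<^esub> a \<otimes>\<^bsub>R\<^esub> (b \<otimes>\<^bsub>R\<^esub> s)) = ?q"
    using R by (simp add: R.ring_simprules)
  moreover have "s \<oplus>\<^bsub>R\<^esub> a \<otimes>\<^bsub>R\<^esub> (b \<otimes>\<^bsub>R\<^esub> s) \<oplus>\<^bsub>R\<^esub> a \<otimes>\<^bsub>R\<^esub> ?q = ?p \<oplus>\<^bsub>R\<^esub> s"
    using R by (simp add: R.ring_simprules)
  moreover have "inv (t j i b) = t j i (\<ominus>\<^bsub>R\<^esub> b)" "inv (t i j a) = t i j (\<ominus>\<^bsub>R\<^esub> a)"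
    using ix R by (simp_all add: t_inv)
  moreover have "cnj (y_elt i j a b) (t i l s) =
      cnj (t i j a) (cnj (t j i b) (cnj (inv (t i j a)) (cnj (inv (t j i b)) (t i l s))))"
    using ix R by (simp add: cnj_cnj cmt_def m_assoc)
  ultimately have "cnj (y_elt i j a b) (t i l s) = col_pair i j l (?p \<oplus>\<^bsub>R\<^esub> s) ?q"
    using ix R by (simp add: cnj_col_pair)
  also have "\<dots> = t i l ?p \<otimes> t j l ?q \<otimes> t i l s"
    using ix R t_add[of i l ?p s] by (simp add: col_pair_def t_commute[of i l j l] m_assoc)
  finally show ?thesis using ix R by (simp add: cmt_eq_cnj_mult m_assoc)
qed

text \<open>On rows the inverse matrix acts from the right, so the coefficients are the first row of
  that inverse minus the identity; again they lie in the ideal generated by ab.\<close>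

lemma cmt_y_row:
  assumes ix: "ix3 i j l" and R: "a \<in> carrier R" "b \<in> carrier R" "s \<in> carrier R"
  shows "cmt (y_elt i j a b) (t l i s) =
    t l i (s \<otimes>\<^bsub>R\<^esub> \<ominus>\<^bsub>R\<^esub> (a \<otimes>\<^bsub>R\<^esub> b)) \<otimes> t l j (s \<otimes>\<^bsub>R\<^esub> (a \<otimes>\<^bsub>R\<^esub> b \<otimes>\<^bsub>R\<^esub> a))"
proof -
  let ?p = "s \<otimes>\<^bsub>R\<^esub> \<ominus>\<^bsub>R\<^esub> (a \<otimes>\<^bsub>R\<^esub> b)" and ?q = "s \<otimes>\<^bsub>R\<^esub> (a \<otimes>\<^bsub>R\<^esub> b \<otimes>\<^bsub>R\<^esub> a)"
  have "cnj (t j i (\<ominus>\<^bsub>R\<^esub> b)) (t l i s) = row_pair i j l s \<zero>\<^bsub>R\<^esub>"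
    using cnj_row_pair(2)[of i j l "\<ominus>\<^bsub>R\<^esub> b" s "\<zero>\<^bsub>R\<^esub>"] ix R by (simp add: row_pair_single)
  moreover have "cnj (t i j (\<ominus>\<^bsub>R\<^esub> a)) (row_pair i j l s \<zero>\<^bsub>R\<^esub>) = row_pair i j l s (s \<otimes>\<^bsub>R\<^esub> a)"
    using ix R by (simp add: cnj_row_pair R.l_minus R.r_minus)
  moreover have "s \<oplus>\<^bsub>R\<^esub> \<ominus>\<^bsub>R\<^esub> (s \<otimes>\<^bsub>R\<^esub> a \<otimes>\<^bsub>R\<^esub> b) = ?p \<oplus>\<^bsub>R\<^esub> s"
    using R by (simp add: R.ring_simprules)
  moreover have "s \<otimes>\<^bsub>R\<^esub> a \<oplus>\<^bsub>R\<^esub> \<ominus>\<^bsub>R\<^esub> ((?p \<oplus>\<^bsub>R\<^esub> s) \<otimes>\<^bsub>R\<^esub> a) = ?q"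
    using R by (simp add: R.ring_simprules)
  moreover have "inv (t j i b) = t j i (\<ominus>\<^bsub>R\<^esub> b)" "inv (t i j a) = t i j (\<ominus>\<^bsub>R\<^esub> a)"
    using ix R by (simp_all add: t_inv)
  moreover have "cnj (y_elt i j a b) (t l i s) =
      cnj (t i j a) (cnj (t j i b) (cnj (inv (t i j a)) (cnj (inv (t j i b)) (t l i s))))"
    using ix R by (simp add: cnj_cnj cmt_def m_assoc)
  ultimately have "cnj (y_elt i j a b) (t l i s) = row_pair i j l (?p \<oplus>\<^bsub>R\<^esub> s) ?q"
    using ix R by (simp add: cnj_row_pair)
  also have "\<dots> = t l i ?p \<otimes> t l j ?q \<otimes> t l i s"
    using ix R t_add[of l i ?p s] by (simp add: row_pair_def t_commute[of l i l j] m_assoc)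
  finally show ?thesis using ix R by (simp add: cmt_eq_cnj_mult m_assoc)
qed

text \<open>
  Expand \<open>t i j a\<close> as the commutator of \<open>t i h a\<close> and \<open>t h j 1\<close>; everything outside the
  new block \<open>{i, h}\<close> is absorbed by the normal subgroup. This moves \<open>y_elt\<close> away from a transvection
  in its own block, with which it has no evident commutation relation.
\<close>

lemma y_swap:
  assumes A: "ideal A R" and B: "ideal B R" and ix: "ix3 i j h" and a: "a \<in> A" and b: "b \<in> B"
  shows "y_elt i j a b \<otimes> y_elt i h a (\<ominus>\<^bsub>R\<^esub> b) \<in> Rel (sym_ideal_prod R A B)"
proof -
  let ?Z = "sym_ideal_prod R A B"
  have R: "a \<in> carrier R" "b \<in> carrier R" using assms ideal.Icarr by fast+
  have Z: "ideal ?Z R" by (rule R.sym_ideal_prod_ideal[OF A B])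
  have S: "subgroup (Rel ?Z) G" by (rule Rel_subgroup[OF ideal_subset[OF Z]])
  have baZ: "b \<otimes>\<^bsub>R\<^esub> a \<in> ?Z" by (rule R.sym_ideal_prodI(2)[OF A B a b])
  \<comment> \<open>Conjugation by \<open>t j i b\<close> turns \<open>x\<close> into
    \<open>f \<otimes> x\<close> and \<open>v\<close> into \<open>w \<otimes> v\<close>. Here
    \<open>f\<close> already lies in \<open>Rel ?Z\<close>, and \<open>cmt x w\<close> is the second
    factor of the claim.\<close>
  define x v w f where "x = t i h a" and "v = t h j \<one>\<^bsub>R\<^esub>" and "w = t h i (\<ominus>\<^bsub>R\<^esub> b)"
    and "f = t j h (b \<otimes>\<^bsub>R\<^esub> a)"
  have c: "x \<in> carrier G" "v \<in> carrier G" "w \<in> carrier G" "f \<in> carrier G"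
    unfolding x_def v_def w_def f_def using ix R by auto
  have norm: "cnj g k \<in> Rel ?Z" if "g \<in> El (carrier R)" "k \<in> Rel ?Z" for g k
    by (rule Rel_normal[OF Z that])
  have xE: "x \<in> El (carrier R)" "v \<in> El (carrier R)" "w \<in> El (carrier R)"
    unfolding x_def v_def w_def using ix R by (auto intro!: t_in_El)
  have fR: "f \<in> Rel ?Z" unfolding f_def using ix by (intro t_in_Rel ideal_subset[OF Z] baZ) auto
  have xv: "t i j a = cmt x v" unfolding x_def v_def using ix R by (simp add: cmt_t)
  have "cnj (t j i b) x = f \<otimes> x"
    unfolding x_def f_def using ix R by (simp add: cnj_t_col)
  moreover have "cnj (t j i b) v = w \<otimes> v"
    unfolding v_def w_def using ix R by (simp add: cnj_t_row)
  ultimately have "cnj (t j i b) (t i j a) = cmt (f \<otimes> x) (w \<otimes> v)"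
    unfolding xv using ix R c by (simp add: cnj_cmt)
  moreover have "y_elt i j a b = t i j a \<otimes> inv (cnj (t j i b) (t i j a))"
    using ix R by (simp add: word_simps)
  ultimately have y: "y_elt i j a b = cmt x v \<otimes> inv (cmt (f \<otimes> x) (w \<otimes> v))"
    by (simp add: xv)
  have "cmt (cmt x v) w = inv (cmt w (t i j a))"
    unfolding xv using c by (simp add: inv_cmt)
  also have "\<dots> = t h j (b \<otimes>\<^bsub>R\<^esub> a)"
    unfolding w_def using ix R by (simp add: cmt_t t_inv R.l_minus)
  finally have "cmt (cmt x v) w \<in> Rel ?Z"
    using ix by (simp add: t_in_Rel ideal_subset[OF Z] baZ)
  moreover have "cnj (cmt x v) (cnj (w \<otimes> v) f) \<in> Rel ?Z"
    using fR xE ix R by (intro norm) (auto simp: xv[symmetric] intro!: t_in_El subgroup.m_closed[OF El_subgroup])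
  moreover have "inv (cnj (inv (cmt x w)) f) \<in> Rel ?Z"
  proof -
    have sE: "subgroup (El (carrier R)) G" by (rule El_subgroup) simp
    have "inv (cmt x w) \<in> El (carrier R)"
      unfolding cmt_def using xE by (intro subgroup.m_inv_closed[OF sE] subgroup.m_closed[OF sE])
    then show ?thesis using fR by (intro subgroup.m_inv_closed[OF S] norm)
  qed
  \<comment> \<open>For trivial \<open>f\<close> this product would be the double commutator
    \<open>cmt (cmt x v) w\<close>, a transvection with coefficient ba; restoring \<open>f\<close>
    adds a conjugate of \<open>f\<close> and the inverse of another.\<close>
  moreover have "y_elt i j a b \<otimes> cmt x w =
      cnj (cmt x v) (cnj (w \<otimes> v) f) \<otimes> cmt (cmt x v) w \<otimes> inv (cnj (inv (cmt x w)) f)"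
    unfolding y using c by (simp add: word_simps)
  ultimately have "y_elt i j a b \<otimes> cmt x w \<in> Rel ?Z" by (simp add: subgroup.m_closed[OF S])
  then show ?thesis unfolding x_def w_def .
qed

lemma y_in_El: "ix i j \<Longrightarrow> a \<in> carrier R \<Longrightarrow> b \<in> carrier R \<Longrightarrow> y_elt i j a b \<in> El (carrier R)"
  unfolding cmt_def using El_subgroup[OF subset_refl]
  by (intro subgroup.m_closed[of "El (carrier R)" G] subgroup.m_inv_closed[of "El (carrier R)" G] t_in_El)
    auto

lemma z_in_El: "ix i j \<Longrightarrow> x \<in> carrier R \<Longrightarrow> r \<in> carrier R \<Longrightarrow> z_elt i j x r \<in> El (carrier R)"
  unfolding cnj_def using El_subgroup[OF subset_refl]
  by (intro subgroup.m_closed[of "El (carrier R)" G] subgroup.m_inv_closed[of "El (carrier R)" G] t_in_El)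
    auto

text \<open>
  Stated for arbitrary \<open>K\<close> and \<open>S\<close> because it is needed both for \<open>K = Rel Z\<close>, where \<open>S\<close> is the
  whole ring, and for \<open>K = Mix Z S\<close>.
\<close>

lemma cmt_y_t:
  assumes A: "ideal A R" and B: "ideal B R" and Z_def: "Z = sym_ideal_prod R A B"
    and SR: "S \<subseteq> carrier R" and K: "subgroup K G"
    and norm: "\<And>g k. g \<in> El (carrier R) \<Longrightarrow> k \<in> K \<Longrightarrow> cnj g k \<in> K"
    and left: "\<And>i j x s. ix i j \<Longrightarrow> x \<in> Z \<Longrightarrow> s \<in> S \<Longrightarrow> t i j (x \<otimes>\<^bsub>R\<^esub> s) \<in> K"
    and right: "\<And>i j x s. ix i j \<Longrightarrow> x \<in> Z \<Longrightarrow> s \<in> S \<Longrightarrow> t i j (s \<otimes>\<^bsub>R\<^esub> x) \<in> K"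
    and rel: "\<And>w k l s. w \<in> Rel Z \<Longrightarrow> ix k l \<Longrightarrow> s \<in> S \<Longrightarrow> cmt w (t k l s) \<in> K"
    and a: "a \<in> A" and b: "b \<in> B" and ij: "ix i j" and kl: "ix k l" and s: "s \<in> S"
  shows "cmt (y_elt i j a b) (t k l s) \<in> K"
proof -
  have Z: "ideal Z R" unfolding Z_def by (rule R.sym_ideal_prod_ideal[OF A B])
  have sR: "s \<in> carrier R" using s SR by auto
  have inv_mem: "cmt (inv x) (t k l s) \<in> K"
    if "x \<in> El (carrier R)" "cmt x (t k l s) \<in> K" "ix k l" for x k l
  proof -
    have "x \<in> carrier G" using that(1) by (rule El_carrier[OF subset_refl])
    then show ?thesis
      using that sR subgroup.m_inv_closed[OF El_subgroup[OF subset_refl]]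
      by (simp add: cmt_inv_left norm subgroup.m_inv_closed[OF K])
  qed
  \<comment> \<open>Exactly the index \<open>i\<close> is shared with the block, so the coefficients
    lie in \<open>Z\<close> and \<open>left\<close>, \<open>right\<close> apply. The claim is
    general in indices and ring elements because it is reused for \<open>y_elt j i b a\<close> and
    for a block containing the third index.\<close>
  have first: "cmt (y_elt i j a b) (t i l s) \<in> K \<and> cmt (y_elt i j a b) (t l i s) \<in> K"
    if "ix3 i j l" "a \<in> carrier R" "b \<in> carrier R" "a \<otimes>\<^bsub>R\<^esub> b \<in> Z" for i j l a b
  proof
    have "b \<otimes>\<^bsub>R\<^esub> a \<otimes>\<^bsub>R\<^esub> b \<in> Z" "a \<otimes>\<^bsub>R\<^esub> b \<otimes>\<^bsub>R\<^esub> a \<in> Z"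
      "a \<otimes>\<^bsub>R\<^esub> b \<oplus>\<^bsub>R\<^esub> a \<otimes>\<^bsub>R\<^esub> b \<otimes>\<^bsub>R\<^esub> (a \<otimes>\<^bsub>R\<^esub> b) \<in> Z" "\<ominus>\<^bsub>R\<^esub> (a \<otimes>\<^bsub>R\<^esub> b) \<in> Z"
      using that Z by (simp_all add: R.ideal_closed R.m_assoc[of b a b])
    then show "cmt (y_elt i j a b) (t i l s) \<in> K" "cmt (y_elt i j a b) (t l i s) \<in> K"
      unfolding cmt_y_col[OF that(1-3) sR] cmt_y_row[OF that(1-3) sR] using that s
      by (blast intro: subgroup.m_closed[OF K] left, blast intro: subgroup.m_closed[OF K] right)
  qed
  \<comment> \<open>This is \<open>first\<close> with \<open>i\<close> and \<open>j\<close>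
    exchanged, as \<open>y_elt i j a b\<close> is the inverse of
    \<open>y_elt j i b a\<close>.\<close>
  have second: "cmt (y_elt i j a b) (t j l s) \<in> K \<and> cmt (y_elt i j a b) (t l j s) \<in> K"
    if "ix3 i j l" "a \<in> carrier R" "b \<in> carrier R" "b \<otimes>\<^bsub>R\<^esub> a \<in> Z" for i j l a b
  proof -
    have "y_elt i j a b = inv (y_elt j i b a)" using that by (simp add: inv_cmt)
    moreover have "cmt (y_elt j i b a) (t j l s) \<in> K \<and> cmt (y_elt j i b a) (t l j s) \<in> K"
      using that by (intro first) auto
    ultimately show ?thesis using that y_in_El[of j i b a] by (auto intro!: inv_mem)
  qed
  have R: "a \<in> carrier R" "b \<in> carrier R" using a b A B ideal.Icarr by fast+
  have ab: "a \<otimes>\<^bsub>R\<^esub> b \<in> Z" "b \<otimes>\<^bsub>R\<^esub> a \<in> Z"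
    unfolding Z_def using R.sym_ideal_prodI[OF A B a b] .
  consider "k = i" "l = j" | "k = j" "l = i" | "k = i" "l \<noteq> j" | "k = j" "l \<noteq> i"
    | "l = i" "k \<noteq> j" | "l = j" "k \<noteq> i" | "k \<notin> {i, j}" "l \<notin> {i, j}" by auto
  then show ?thesis
  proof cases
    case 7
    then have "cmt (y_elt i j a b) (t k l s) = inv (cmt (t k l s) (y_elt i j a b))"
      using ij kl R sR by (simp add: inv_cmt)
    also have "cnj (t k l s) (y_elt i j a b) = y_elt i j a b"
      using 7 ij kl R sR by (simp add: cnj_cmt cnj_t_commute)
    then have "inv (cmt (t k l s) (y_elt i j a b)) = \<one>"
      using ij kl R sR by (simp add: cmt_eq_cnj_mult)
    finally show ?thesis using subgroup.one_closed[OF K] by simp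
  next
    case 3 then show ?thesis using first[of i j l a b] ij kl R ab by auto
  next
    case 5 then show ?thesis using first[of i j k a b] ij kl R ab by auto
  next
    case 4 then show ?thesis using second[of i j l a b] ij kl R ab by auto
  next
    case 6 then show ?thesis using second[of i j k a b] ij kl R ab by auto
  next
    \<comment> \<open>For a transvection in the block {i,j} itself, \<open>y_swap\<close> replaces
      \<open>y_elt i j a b\<close> by the inverse of \<open>?y\<close> up to a factor in
      \<open>Rel Z\<close>. With the new block {i,h} the transvection shares only \<open>i\<close>,
      so \<open>first\<close> applies.\<close>
    have *: "cmt (y_elt i j a b) (t k l s) \<in> K" if kl': "k = i \<and> l = j \<or> k = j \<and> l = i"
    proof -
      obtain h where h: "ix3 i j h" using third_index[OF ij] .
      let ?y = "y_elt i h a (\<ominus>\<^bsub>R\<^esub> b)"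
      let ?w = "y_elt i j a b \<otimes> ?y"
      have w: "?w \<in> Rel Z" unfolding Z_def by (rule y_swap[OF A B h a b])
      have yE: "?y \<in> El (carrier R)" "y_elt i j a b \<in> El (carrier R)"
        using h R by (auto intro!: y_in_El)
      then have wE: "?w \<in> El (carrier R)"
        by (rule subgroup.m_closed[OF El_subgroup[OF subset_refl], rotated])
      have "cmt ?y (t k l s) \<in> K"
        using first[of i h j a "\<ominus>\<^bsub>R\<^esub> b"] kl' h R ab Z by (auto simp: R.r_minus R.ideal_closed)
      then have "cmt (inv ?y) (t k l s) \<in> K" using kl by (intro inv_mem yE)
      then have "cnj ?w (cmt (inv ?y) (t k l s)) \<otimes> cmt ?w (t k l s) \<in> K"
        by (rule subgroup.m_closed[OF K norm[OF wE] rel[OF w kl s]])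
      also have "cnj ?w (cmt (inv ?y) (t k l s)) \<otimes> cmt ?w (t k l s) = cmt (?w \<otimes> inv ?y) (t k l s)"
        using h R sR kl by (intro cmt_mult_left[symmetric]) auto
      also have "?w \<otimes> inv ?y = y_elt i j a b" using h R by (simp add: m_assoc)
      finally show ?thesis .
    qed
    { case 1 then show ?thesis using * by simp
    next case 2 then show ?thesis using * by simp }
  qed
qed

section \<open>Generators and normality of the mixed commutator subgroup\<close>

text \<open>For fixed \<open>r\<close>, \<open>z_elt i j x r\<close> is multiplicative over sums in
  \<open>x\<close>, so \<open>x\<close> may be taken to be a product. Then \<open>z_eq_cmt\<close>
  with s = 0 makes it a commutator of a vector over one ideal with a vector over the other.\<close>

lemma Rel_sub_Mix:
  assumes I: "ideal I R" and J: "ideal J R"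
  shows "Rel (sym_ideal_prod R I J) \<subseteq> Mix I J"
proof -
  let ?M = "Mix I J"
  note IJ = ideal_subset[OF I] ideal_subset[OF J]
  have M: "subgroup ?M G" by (rule Mix_subgroup[OF IJ])
  have "z_elt i j x r \<in> ?M" if ij: "ix i j" and r: "r \<in> carrier R" and x: "x \<in> sym_ideal_prod R I J"
    for i j x r
  proof -
    obtain h where h: "ix3 i j h" using third_index[OF ij] .
    have z0: "cnj (t i j \<zero>\<^bsub>R\<^esub>) (z_elt i j c r) = z_elt i j c r" if "c \<in> carrier R" for c
      using ij r that by (simp add: cnj_def)
    show ?thesis using x
    proof (induction rule: R.sym_ideal_prod_induct[OF I J, consumes 1])
      case (1 a b)
      then have c: "a \<otimes>\<^bsub>R\<^esub> b \<in> carrier R" using IJ by auto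
      obtain u v where "u \<in> col_pairs i j h I" "v \<in> row_pairs i j h J" "z_elt i j (a \<otimes>\<^bsub>R\<^esub> b) r = cmt u v"
        using z_eq_cmt[OF I J h 1 r R.zero_closed] unfolding z0[OF c] by blast
      then show ?case using pairs_El[OF I h] pairs_El[OF J h] by (auto intro: cmt_in_Mix)
    next
      case (2 a b)
      then have c: "b \<otimes>\<^bsub>R\<^esub> a \<in> carrier R" using IJ by auto
      obtain u v where "u \<in> col_pairs i j h J" "v \<in> row_pairs i j h I" "z_elt i j (b \<otimes>\<^bsub>R\<^esub> a) r = cmt u v"
        using z_eq_cmt[OF J I h 2(2,1) r R.zero_closed] unfolding z0[OF c] by blast
      then show ?case using pairs_El[OF I h] pairs_El[OF J h] by (auto intro: cmt_in_Mix'[OF IJ])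
    next
      case (3 p q)
      then have "z_elt i j (p \<oplus>\<^bsub>R\<^esub> q) r = z_elt i j p r \<otimes> z_elt i j q r"
        using ij r by (simp add: t_add[symmetric] cnj_mult)
      with 3 show ?case by (simp add: subgroup.m_closed[OF M])
    qed
  qed
  then show ?thesis unfolding Rel_def by (intro generate_subgroup_incl[OF _ M]) auto
qed

text \<open>This is \<open>cmt_y_t\<close> with the whole ring as \<open>S\<close>, where the
  condition on elements of \<open>Rel\<close> follows from normality. It provides the centrality
  from which \<open>Mix_normal\<close> is derived.\<close>

lemma cmt_y_t_in_Rel:
  assumes A: "ideal A R" and B: "ideal B R" and "a \<in> A" "b \<in> B" "ix i j" "ix k l" "s \<in> carrier R"
  shows "cmt (y_elt i j a b) (t k l s) \<in> Rel (sym_ideal_prod R A B)"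
proof -
  let ?Z = "sym_ideal_prod R A B"
  have Z: "ideal ?Z R" by (rule R.sym_ideal_prod_ideal[OF A B])
  note ZR = ideal_subset[OF Z]
  have S: "subgroup (Rel ?Z) G" by (rule Rel_subgroup[OF ZR])
  show ?thesis
  proof (rule cmt_y_t[OF A B refl subset_refl S Rel_normal[OF Z] _ _ _ assms(3-)])
    fix w k l s assume w: "w \<in> Rel ?Z" and kl: "ix k l" "s \<in> carrier R"
    have c: "w \<in> carrier G" "t k l s \<in> carrier G" using kl subgroup.mem_carrier[OF S w] by auto
    have "cnj (t k l s) w \<in> Rel ?Z" using w kl by (intro Rel_normal[OF Z] t_in_El)
    moreover have "cmt w (t k l s) = w \<otimes> inv (cnj (t k l s) w)" using c by (simp add: word_simps)
    ultimately show "cmt w (t k l s) \<in> Rel ?Z"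
      using w by (simp add: subgroup.m_closed[OF S] subgroup.m_inv_closed[OF S])
  qed (auto intro!: t_in_Rel ZR simp: R.ideal_closed Z)
qed

definition RelY :: "'a set \<Rightarrow> 'a set \<Rightarrow> 'g set" where
  "RelY A B = Rel (sym_ideal_prod R A B) \<union> {y_elt i j a b | i j a b. i < n \<and> j < n \<and> i \<noteq> j \<and> a \<in> A \<and> b \<in> B}"

text \<open>The subgroup generated by \<open>RelY I J\<close> is normalised by
  \<open>El (carrier R)\<close> because the elements \<open>y_elt i j a b\<close> are central modulo
  \<open>Rel\<close>. With this, \<open>cmt_generate\<close> reduces the inclusion of
  \<open>Mix I J\<close> to commutators of two transvections, so both facts are proved
  together.\<close>

lemma
  assumes I: "ideal I R" and J: "ideal J R"
  shows Mix_eq_generate: "Mix I J = generate G (RelY I J)"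
    and Mix_normal: "g \<in> El (carrier R) \<Longrightarrow> w \<in> Mix I J \<Longrightarrow> cnj g w \<in> Mix I J"
proof -
  let ?Z = "sym_ideal_prod R I J" and ?N = "generate G (RelY I J)"
  note IJ = ideal_subset[OF I] ideal_subset[OF J]
  have Z: "ideal ?Z R" by (rule R.sym_ideal_prod_ideal[OF I J])
  have SR: "subgroup (Rel ?Z) G" by (rule Rel_subgroup[OF ideal_subset[OF Z]])
  have RelY_carrier: "RelY I J \<subseteq> carrier G"
    using IJ subgroup.subset[OF SR] by (auto simp: RelY_def intro!: cmt_closed)
  have N: "subgroup ?N G" by (rule generate_is_subgroup[OF RelY_carrier])
  have Rel_N: "w \<in> Rel ?Z \<Longrightarrow> w \<in> ?N" for w
    by (rule generate.incl) (simp add: RelY_def)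
  have y_N: "ix i j \<Longrightarrow> a \<in> I \<Longrightarrow> b \<in> J \<Longrightarrow> y_elt i j a b \<in> ?N" for i j a b
    by (rule generate.incl) (auto simp: RelY_def)
  have normal: "cnj g w \<in> ?N" if "g \<in> El (carrier R)" "w \<in> ?N" for g w
  proof (rule cnj_El_closed[OF subgroup.subset[OF N] _ that])
    fix k l s w assume kl: "ix k l" "s \<in> carrier R" and w: "w \<in> ?N"
    then have tG: "t k l s \<in> carrier G" by simp
    show "cnj (t k l s) w \<in> ?N"
    proof (rule cnj_generate[OF RelY_carrier N tG _ w])
      fix x assume "x \<in> RelY I J"
      then consider "x \<in> Rel ?Z"
        | i j a b where "x = y_elt i j a b" "ix i j" "a \<in> I" "b \<in> J"
        unfolding RelY_def by blast
      then show "cnj (t k l s) x \<in> ?N"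
      proof cases
        case 1 then show ?thesis using kl by (intro Rel_N Rel_normal[OF Z] t_in_El)
      next
        case 2
        then have "x \<in> ?N" "cmt x (t k l s) \<in> ?N"
          using kl y_N cmt_y_t_in_Rel[OF I J, of a b i j k l s, THEN Rel_N] by auto
        then show ?thesis using tG by (intro cnj_mem_if_cmt_mem[OF N])
      qed
    qed
  qed
  have "Mix I J \<subseteq> ?N"
  proof -
    have SE: "subgroup (El (carrier R)) G" by (rule El_subgroup) simp
    have st: "cmt s u \<in> ?N"
      if s: "s \<in> {t i j a | i j a. i < n \<and> j < n \<and> i \<noteq> j \<and> a \<in> I}"
        and u: "u \<in> {t i j a | i j a. i < n \<and> j < n \<and> i \<noteq> j \<and> a \<in> J}" for s u
    proof -
      obtain i j a where s: "s = t i j a" "ix i j" "a \<in> I" using s by blast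
      obtain k l b where u: "u = t k l b" "ix k l" "b \<in> J" using u by blast
      have R: "a \<in> carrier R" "b \<in> carrier R" using s u IJ by auto
      note ab = R.sym_ideal_prodI[OF I J s(3) u(3)]
      \<comment> \<open>Opposite transvections give a \<open>y_elt\<close>; a single matching index
        gives, up to inversion, a transvection with coefficient ab or ba; otherwise they
        commute.\<close>
      consider "k = j" "l = i" | "k = j" "l \<noteq> i" | "k \<noteq> j" "l = i" | "k \<noteq> j" "l \<noteq> i" by blast
      then show ?thesis
      proof cases
        case 1 then show ?thesis using s u y_N by simp
      next
        case 2
        then have "cmt s u = t i l (a \<otimes>\<^bsub>R\<^esub> b)" using s u R by (simp add: cmt_t)
        then show ?thesis using s u 2 ab
          by (simp add: Rel_N t_in_Rel[OF ideal_subset[OF Z]])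
      next
        case 3
        then have "cmt u s = t k j (b \<otimes>\<^bsub>R\<^esub> a)" using s u R by (simp add: cmt_t)
        then have "cmt u s \<in> ?N" using s u 3 ab
          by (simp add: Rel_N t_in_Rel[OF ideal_subset[OF Z]])
        moreover have "s \<in> carrier G" "u \<in> carrier G" using s u R by auto
        ultimately show ?thesis using cmt_swap_mem[OF N] by blast
      next
        case 4
        then have "cmt s u = \<one>" using s u R by (simp add: cmt_eq_cnj_mult cnj_t_commute)
        then show ?thesis using subgroup.one_closed[OF N] by simp
      qed
    qed
    have "cmt f h \<in> ?N" if "f \<in> El I" "h \<in> El J" for f h
      by (rule cmt_generate[OF _ _ SE N normal st that[unfolded El_def]])
        (use IJ in \<open>auto intro!: t_in_El\<close>)
    then show ?thesis unfolding Mix_eq by (intro generate_subgroup_incl[OF _ N]) auto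
  qed
  moreover have "?N \<subseteq> Mix I J"
    using Rel_sub_Mix[OF I J]
    by (intro generate_subgroup_incl[OF _ Mix_subgroup[OF IJ]])
      (auto simp: RelY_def intro!: cmt_in_Mix t_in_El)
  ultimately show eq: "Mix I J = ?N" by blast
  show "g \<in> El (carrier R) \<Longrightarrow> w \<in> Mix I J \<Longrightarrow> cnj g w \<in> Mix I J"
    unfolding eq by (rule normal)
qed

section \<open>Commutators with the third elementary subgroup\<close>

text \<open>Unless (k,l) = (i,j), conjugating \<open>t k l c\<close> by the inverse of
  \<open>t j i r\<close> stays in \<open>El J\<close>, so the conjugation in
  \<open>z_elt i j x r\<close> can be pulled out by normality. In the remaining case
  \<open>z_elt i j x r\<close> is written as \<open>cmt u v\<close> with a column \<open>u\<close>
  over \<open>I\<close> and a row \<open>v\<close>.\<close>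

lemma Rel_El_in_Mix:
  assumes I: "ideal I R" and J: "ideal J R" and w: "w \<in> Rel I" and h: "h \<in> El J"
  shows "cmt w h \<in> Mix I J"
proof -
  note IJ = ideal_subset[OF I] ideal_subset[OF J]
  have M: "subgroup (Mix I J) G" by (rule Mix_subgroup[OF IJ])
  have SE: "subgroup (El (carrier R)) G" by (rule El_subgroup) simp
  have SJ: "subgroup (El J) G" by (rule El_subgroup[OF IJ(2)])
  have "cmt (z_elt i j x r) (t k l c) \<in> Mix I J"
    if ij: "ix i j" "x \<in> I" "r \<in> carrier R" and kl: "ix k l" "c \<in> J" for i j x r k l c
  proof -
    have R: "x \<in> carrier R" "c \<in> carrier R" using that IJ by auto
    show ?thesis
    proof (cases "k = i \<and> l = j")
      case False
      let ?g = "t j i r"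
      have g: "?g \<in> carrier G" "inv ?g = t j i (\<ominus>\<^bsub>R\<^esub> r)" using ij by (simp_all add: t_inv)
      have "cnj (inv ?g) (t k l c) \<in> El J"
      proof -
        consider "k \<noteq> i" "l \<noteq> j" | "k = i" "l \<noteq> j" | "k \<noteq> i" "l = j" using False by blast
        then show ?thesis
        proof cases
          case 1
          then show ?thesis unfolding g(2) using ij kl R by (simp add: cnj_t_commute t_in_El)
        next
          case 2
          then show ?thesis unfolding g(2) using ij kl R J
            by (auto simp: cnj_t_col R.ideal_closed intro!: subgroup.m_closed[OF SJ] t_in_El)
        next
          case 3
          then show ?thesis unfolding g(2) using ij kl R J
            by (auto simp: cnj_t_row R.ideal_closed intro!: subgroup.m_closed[OF SJ] t_in_El)
        qed
      qed
      then have "cnj ?g (cmt (t i j x) (cnj (inv ?g) (t k l c))) \<in> Mix I J"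
        using ij by (intro Mix_normal[OF I J] t_in_El cmt_in_Mix) auto
      then show ?thesis using ij kl R g(1) by (simp add: cnj_cmt)
    next
      case True
      obtain h where h: "ix3 i j h" using third_index ij by blast
      have z0: "cnj (t i j \<zero>\<^bsub>R\<^esub>) (z_elt i j x r) = z_elt i j x r" using ij R by (simp add: cnj_def)
      obtain u v where uv: "u \<in> col_pairs i j h I" "v \<in> row_pairs i j h (carrier R)"
        "cnj (t i j \<zero>\<^bsub>R\<^esub>) (z_elt i j (x \<otimes>\<^bsub>R\<^esub> \<one>\<^bsub>R\<^esub>) r) = cmt u v"
        using z_eq_cmt[OF I R.oneideal h ij(2) R.one_closed ij(3) R.zero_closed] by blast
      then have eq: "z_elt i j x r = cmt u v" using z0 R by simp
      have uE: "u \<in> El I" and vE: "v \<in> El (carrier R)"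
        using uv pairs_El[OF I h] pairs_El[OF R.oneideal h] by auto
      have G: "u \<in> carrier G" "v \<in> carrier G"
        using El_carrier[OF IJ(1) uE] El_carrier[OF subset_refl vE] .
      \<comment> \<open>The entries of a row commute, so inversion only changes their signs. Hence
        conjugation by \<open>inv v\<close> multiplies \<open>t i j c\<close> by a transvection with
        coefficient in \<open>J\<close>.\<close>
      have "inv v \<in> row_pairs i j h (carrier R)"
      proof -
        obtain p q where v: "v = row_pair i j h p q" "p \<in> carrier R" "q \<in> carrier R"
          using uv(2) by (rule row_pairsE)
        then have "inv v = row_pair i j h (\<ominus>\<^bsub>R\<^esub> p) (\<ominus>\<^bsub>R\<^esub> q)"
          using h row_pair_swap[of i j h p q] by (simp add: row_pair_def inv_mult_group t_inv)
        then show ?thesis using v by (auto intro!: row_pairsI)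
      qed
      then obtain p q where v: "inv v = row_pair i j h p q" "p \<in> carrier R" "q \<in> carrier R"
        by (rule row_pairsE)
      let ?t = "t i j c"
      have "cmt ?t (inv v) \<in> El J"
        unfolding v(1) using h v R kl J by (simp add: cmt_t_row_pair R.ideal_closed t_in_El)
      then have "cnj (inv v) ?t \<in> El J"
        using h G R kl by (intro cnj_mem_if_cmt_mem[OF SJ] t_in_El) auto
      then have 1: "cnj v (cmt (inv u) (cnj (inv v) ?t)) \<in> Mix I J"
        using uE vE by (intro Mix_normal[OF I J] cmt_in_Mix subgroup.m_inv_closed[OF El_subgroup[OF IJ(1)]])
      have "u \<in> El (carrier R)" using uE El_mono[OF IJ(1)] by auto
      note 2 = Mix_normal[OF I J this 1]
      have "cmt u ?t \<in> Mix I J" using uE h kl by (intro cmt_in_Mix t_in_El) auto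
      with 2 have "cnj u (cnj v (cmt (inv u) (cnj (inv v) ?t))) \<otimes> cmt u ?t \<in> Mix I J"
        by (rule subgroup.m_closed[OF M])
      \<comment> \<open>\<open>cmt u v\<close> is \<open>u\<close> times the conjugate of
        \<open>inv u\<close> by \<open>v\<close>; expanding its commutator with \<open>?t\<close> in
        the left argument gives this product.\<close>
      also have "cnj u (cnj v (cmt (inv u) (cnj (inv v) ?t))) \<otimes> cmt u ?t = cmt (cmt u v) ?t"
        using G h R by (simp add: word_simps)
      finally show ?thesis using eq True by simp
    qed
  qed
  then show ?thesis
    by (intro cmt_generate[OF _ _ SE M Mix_normal[OF I J] _ w[unfolded Rel_def] h[unfolded El_def]])
      (use IJ in \<open>auto intro!: t_in_El z_in_El\<close>)
qed

text \<open>One inclusion holds because \<open>El ?Z\<close> lies in \<open>Mix A B\<close>. For the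
  other, \<open>?K\<close> is normalised by \<open>El (carrier R)\<close>, so only commutators of
  \<open>RelY A B\<close> with transvections over \<open>X\<close> remain;
  \<open>Rel_El_in_Mix\<close> and \<open>cmt_y_t\<close> handle them.\<close>

theorem double_commutator:
  assumes A: "ideal A R" and B: "ideal B R" and X: "ideal X R"
  shows "mixed_commutator G (Mix A B) (El X) = Mix (sym_ideal_prod R A B) X"
proof
  let ?Z = "sym_ideal_prod R A B"
  let ?K = "Mix ?Z X"
  have Z: "ideal ?Z R" by (rule R.sym_ideal_prod_ideal[OF A B])
  note sub = ideal_subset[OF A] ideal_subset[OF B] ideal_subset[OF X] ideal_subset[OF Z]
  have "El ?Z \<subseteq> Mix A B" using El_sub_Rel[OF sub(4)] Rel_sub_Mix[OF A B] by blast
  then show "?K \<subseteq> mixed_commutator G (Mix A B) (El X)"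
    unfolding mixed_commutator_def[of G "El ?Z"] mixed_commutator_def[of G "Mix A B"]
    by (intro mono_generate) blast
  have K: "subgroup ?K G" by (rule Mix_subgroup[OF sub(4,3)])
  have SE: "subgroup (El (carrier R)) G" by (rule El_subgroup) simp
  \<comment> \<open>These are the conditions \<open>left\<close> and \<open>right\<close> of
    \<open>cmt_y_t\<close> for S = X: the coefficients lie in the symmetrised product of
    \<open>?Z\<close> and \<open>X\<close>.\<close>
  have prod: "t i j (x \<otimes>\<^bsub>R\<^esub> s) \<in> ?K" "t i j (s \<otimes>\<^bsub>R\<^esub> x) \<in> ?K"
    if ij: "ix i j" and xs: "x \<in> ?Z" "s \<in> X" for i j x s
  proof -
    have "x \<otimes>\<^bsub>R\<^esub> s \<in> sym_ideal_prod R ?Z X" "s \<otimes>\<^bsub>R\<^esub> x \<in> sym_ideal_prod R ?Z X"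
      by (rule R.sym_ideal_prodI[OF Z X xs])+
    then have "t i j (x \<otimes>\<^bsub>R\<^esub> s) \<in> Rel (sym_ideal_prod R ?Z X)"
      "t i j (s \<otimes>\<^bsub>R\<^esub> x) \<in> Rel (sym_ideal_prod R ?Z X)"
      by (auto intro!: t_in_Rel ideal_subset R.sym_ideal_prod_ideal Z X ij[THEN conjunct1] simp: ij)
    then show "t i j (x \<otimes>\<^bsub>R\<^esub> s) \<in> ?K" "t i j (s \<otimes>\<^bsub>R\<^esub> x) \<in> ?K"
      using Rel_sub_Mix[OF Z X] by auto
  qed
  have gens: "cmt w (t k l s) \<in> ?K" if w: "w \<in> RelY A B" and kl: "ix k l" "s \<in> X" for w k l s
  proof -
    have rel: "cmt w (t k l s) \<in> ?K" if "w \<in> Rel ?Z" "ix k l" "s \<in> X" for w k l s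
      using that by (intro Rel_El_in_Mix[OF Z X] t_in_El)
    consider "w \<in> Rel ?Z" | i j a b where "w = y_elt i j a b" "ix i j" "a \<in> A" "b \<in> B"
      using w unfolding RelY_def by blast
    then show ?thesis
    proof cases
      case 1 then show ?thesis using kl by (rule rel)
    next
      case 2
      show ?thesis unfolding 2(1)
        by (rule cmt_y_t[OF A B refl sub(3) K Mix_normal[OF Z X] prod rel 2(3,4,2) kl])
    qed
  qed
  have RelY_El: "RelY A B \<subseteq> El (carrier R)"
  proof -
    have "Rel ?Z \<subseteq> El (carrier R)"
      unfolding Rel_def using sub(4) by (intro generate_subgroup_incl[OF _ SE]) (auto intro!: z_in_El)
    then show ?thesis using sub by (auto simp: RelY_def intro!: y_in_El)
  qed
  have "cmt f h \<in> ?K" if "f \<in> Mix A B" "h \<in> El X" for f h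
    by (rule cmt_generate[OF RelY_El _ SE K Mix_normal[OF Z X] _
          that(1)[unfolded Mix_eq_generate[OF A B]] that(2)[unfolded El_def]])
      (use sub(3) gens in \<open>auto intro!: t_in_El\<close>)
  then show "mixed_commutator G (Mix A B) (El X) \<subseteq> ?K"
    unfolding mixed_commutator_def[of G "Mix A B"]
    by (intro generate_subgroup_incl[OF _ K]) (auto simp: cmt_def)
qed

end

section \<open>Transvections\<close>

lemma (in abelian_monoid) finsum_swap:
  assumes "finite A" "finite B" "\<And>a b. a \<in> A \<Longrightarrow> b \<in> B \<Longrightarrow> f a b \<in> carrier G"
  shows "(\<Oplus>a\<in>A. \<Oplus>b\<in>B. f a b) = (\<Oplus>b\<in>B. \<Oplus>a\<in>A. f a b)"
  using assms(1,3)
proof (induction A rule: finite_induct)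
  case empty
  then show ?case by simp
next
  case (insert x F)
  have f: "f x b \<in> carrier G" "(\<Oplus>a\<in>F. f a b) \<in> carrier G" if "b \<in> B" for b
    using insert.prems that by (auto intro!: finsum_closed)
  have "(\<Oplus>a\<in>insert x F. \<Oplus>b\<in>B. f a b) = (\<Oplus>b\<in>B. f x b) \<oplus> (\<Oplus>b\<in>B. \<Oplus>a\<in>F. f a b)"
    using insert by (subst finsum_insert) (auto intro!: finsum_closed)
  also have "\<dots> = (\<Oplus>b\<in>B. f x b \<oplus> (\<Oplus>a\<in>F. f a b))"
    using f by (intro finsum_addf[symmetric]) auto
  also have "\<dots> = (\<Oplus>b\<in>B. \<Oplus>a\<in>insert x F. f a b)"
    using insert f by (intro finsum_cong') (auto intro!: finsum_closed)
  finally show ?case .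
qed

context ring
begin

section \<open>The monoid of square matrices\<close>

lemma mem_mat_monoid_iff:
  "M \<in> carrier (mat_monoid R n) \<longleftrightarrow>
    dim_row M = n \<and> dim_col M = n \<and> (\<forall>i<n. \<forall>j<n. M $$ (i, j) \<in> carrier R)"
proof
  assume "M \<in> carrier (mat_monoid R n)"
  then show "dim_row M = n \<and> dim_col M = n \<and> (\<forall>i<n. \<forall>j<n. M $$ (i, j) \<in> carrier R)"
    unfolding mat_monoid_def by (auto intro!: elements_matI)
next
  assume "dim_row M = n \<and> dim_col M = n \<and> (\<forall>i<n. \<forall>j<n. M $$ (i, j) \<in> carrier R)"
  then show "M \<in> carrier (mat_monoid R n)"
    unfolding mat_monoid_def by (auto dest!: elements_matD intro: carrier_matI)
qed

lemma mat_monoid_mult: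
  "M \<otimes>\<^bsub>mat_monoid R n\<^esub> N = mat n n (\<lambda>(i, j). \<Oplus>k\<in>{..<n}. M $$ (i, k) \<otimes> N $$ (k, j))"
  by (simp add: mat_monoid_def)

lemma mat_monoid_one:
  "\<one>\<^bsub>mat_monoid R n\<^esub> = mat n n (\<lambda>(i, j). if i = j then \<one> else \<zero>)"
  by (simp add: mat_monoid_def)

lemma mat_monoid: "monoid (mat_monoid R n)"
proof (rule monoidI)
  fix M N assume "M \<in> carrier (mat_monoid R n)" "N \<in> carrier (mat_monoid R n)"
  then show "M \<otimes>\<^bsub>mat_monoid R n\<^esub> N \<in> carrier (mat_monoid R n)"
    by (auto simp: mem_mat_monoid_iff mat_monoid_mult intro!: finsum_closed)
next
  show "\<one>\<^bsub>mat_monoid R n\<^esub> \<in> carrier (mat_monoid R n)"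
    by (simp add: mem_mat_monoid_iff mat_monoid_one)
next
  fix L M N
  assume *: "L \<in> carrier (mat_monoid R n)" "M \<in> carrier (mat_monoid R n)"
    "N \<in> carrier (mat_monoid R n)"
  have "(\<Oplus>k\<in>{..<n}. (L \<otimes>\<^bsub>mat_monoid R n\<^esub> M) $$ (i, k) \<otimes> N $$ (k, j)) =
      (\<Oplus>l\<in>{..<n}. L $$ (i, l) \<otimes> (M \<otimes>\<^bsub>mat_monoid R n\<^esub> N) $$ (l, j))"
    if ij: "i < n" "j < n" for i j
  proof -
    have "(\<Oplus>k\<in>{..<n}. (L \<otimes>\<^bsub>mat_monoid R n\<^esub> M) $$ (i, k) \<otimes> N $$ (k, j)) =
        (\<Oplus>k\<in>{..<n}. (\<Oplus>l\<in>{..<n}. L $$ (i, l) \<otimes> M $$ (l, k)) \<otimes> N $$ (k, j))"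
      using * ij unfolding mem_mat_monoid_iff
      by (intro finsum_cong') (auto simp: mat_monoid_mult intro!: finsum_closed)
    also have "\<dots> = (\<Oplus>k\<in>{..<n}. \<Oplus>l\<in>{..<n}. L $$ (i, l) \<otimes> (M $$ (l, k) \<otimes> N $$ (k, j)))"
      using * ij unfolding mem_mat_monoid_iff
      by (intro finsum_cong' refl, simp add: Pi_def)
        (subst finsum_ldistr, auto intro!: finsum_cong' simp: m_assoc)
    also have "\<dots> = (\<Oplus>l\<in>{..<n}. \<Oplus>k\<in>{..<n}. L $$ (i, l) \<otimes> (M $$ (l, k) \<otimes> N $$ (k, j)))"
      using * ij unfolding mem_mat_monoid_iff by (intro finsum_swap) auto
    also have "\<dots> = (\<Oplus>l\<in>{..<n}. L $$ (i, l) \<otimes> (\<Oplus>k\<in>{..<n}. M $$ (l, k) \<otimes> N $$ (k, j)))"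
      using * ij unfolding mem_mat_monoid_iff
      by (intro finsum_cong' refl, simp add: Pi_def)
        (subst finsum_rdistr, auto)
    also have "\<dots> = (\<Oplus>l\<in>{..<n}. L $$ (i, l) \<otimes> (M \<otimes>\<^bsub>mat_monoid R n\<^esub> N) $$ (l, j))"
      using * ij unfolding mem_mat_monoid_iff
      by (intro finsum_cong') (auto simp: mat_monoid_mult intro!: finsum_closed)
    finally show ?thesis .
  qed
  then show "L \<otimes>\<^bsub>mat_monoid R n\<^esub> M \<otimes>\<^bsub>mat_monoid R n\<^esub> N =
      L \<otimes>\<^bsub>mat_monoid R n\<^esub> (M \<otimes>\<^bsub>mat_monoid R n\<^esub> N)"
    unfolding mat_monoid_mult[where M = "L \<otimes>\<^bsub>mat_monoid R n\<^esub> M" and N = N]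
      mat_monoid_mult[where M = L and N = "M \<otimes>\<^bsub>mat_monoid R n\<^esub> N"]
    by (intro eq_matI) simp_all
next
  fix M assume M: "M \<in> carrier (mat_monoid R n)"
  have l: "(\<Oplus>k\<in>{..<n}. \<one>\<^bsub>mat_monoid R n\<^esub> $$ (i, k) \<otimes> M $$ (k, j)) = M $$ (i, j)"
    and r: "(\<Oplus>k\<in>{..<n}. M $$ (i, k) \<otimes> \<one>\<^bsub>mat_monoid R n\<^esub> $$ (k, j)) = M $$ (i, j)"
    if ij: "i < n" "j < n" for i j
  proof -
    have c: "M $$ (k, l) \<in> carrier R" if "k < n" "l < n" for k l
      using M that by (simp add: mem_mat_monoid_iff)
    have "(\<Oplus>k\<in>{..<n}. \<one>\<^bsub>mat_monoid R n\<^esub> $$ (i, k) \<otimes> M $$ (k, j)) =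
        (\<Oplus>k\<in>{..<n}. if i = k then M $$ (k, j) else \<zero>)"
      using ij by (intro finsum_cong') (auto simp: c mat_monoid_one)
    also have "\<dots> = M $$ (i, j)" using ij c by (intro finsum_singleton) auto
    finally show "(\<Oplus>k\<in>{..<n}. \<one>\<^bsub>mat_monoid R n\<^esub> $$ (i, k) \<otimes> M $$ (k, j)) = M $$ (i, j)" .
    have "(\<Oplus>k\<in>{..<n}. M $$ (i, k) \<otimes> \<one>\<^bsub>mat_monoid R n\<^esub> $$ (k, j)) =
        (\<Oplus>k\<in>{..<n}. if j = k then M $$ (i, k) else \<zero>)"
      using ij by (intro finsum_cong') (auto simp: c mat_monoid_one)
    also have "\<dots> = M $$ (i, j)" using ij c by (intro finsum_singleton) auto
    finally show "(\<Oplus>k\<in>{..<n}. M $$ (i, k) \<otimes> \<one>\<^bsub>mat_monoid R n\<^esub> $$ (k, j)) = M $$ (i, j)" .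
  qed
  show "\<one>\<^bsub>mat_monoid R n\<^esub> \<otimes>\<^bsub>mat_monoid R n\<^esub> M = M"
    using M unfolding mat_monoid_mult
    by (intro eq_matI) (auto simp: l mem_mat_monoid_iff)
  show "M \<otimes>\<^bsub>mat_monoid R n\<^esub> \<one>\<^bsub>mat_monoid R n\<^esub> = M"
    using M unfolding mat_monoid_mult
    by (intro eq_matI) (auto simp: r mem_mat_monoid_iff)
qed

section \<open>Steinberg relations for transvections\<close>

lemma transvection_closed:
  "c \<in> carrier R \<Longrightarrow> transvection R n i j c \<in> carrier (mat_monoid R n)"
  by (simp add: mem_mat_monoid_iff transvection_def)

text \<open>Splitting a transvection into identity and matrix unit collapses the sums in the
  product, so the relations below become comparisons of entries without sums.\<close>

lemma transvection_mult_left: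
  assumes "i < n" "j < n" "c \<in> carrier R" "M \<in> carrier (mat_monoid R n)"
  shows "transvection R n i j c \<otimes>\<^bsub>mat_monoid R n\<^esub> M =
    mat n n (\<lambda>(k, l). M $$ (k, l) \<oplus> (if k = i then c \<otimes> M $$ (j, l) else \<zero>))"
proof (rule eq_matI)
  fix k l assume "k < dim_row (mat n n (\<lambda>(k, l). M $$ (k, l) \<oplus> (if k = i then c \<otimes> M $$ (j, l) else \<zero>)))"
    "l < dim_col (mat n n (\<lambda>(k, l). M $$ (k, l) \<oplus> (if k = i then c \<otimes> M $$ (j, l) else \<zero>)))"
  then have kl: "k < n" "l < n" by auto
  have M: "M $$ (k, l) \<in> carrier R" if "k < n" "l < n" for k l
    using assms(4) that by (simp add: mem_mat_monoid_iff)
  \<comment> \<open>\<open>?f\<close> comes from the identity, \<open>?g\<close> from the matrix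
    unit; the condition on \<open>m\<close> is outermost so that \<open>finsum_singleton\<close>
    picks out the one term.\<close>
  let ?f = "\<lambda>m. if k = m then M $$ (m, l) else \<zero>"
  let ?g = "\<lambda>m. if j = m then (if k = i then c \<otimes> M $$ (m, l) else \<zero>) else \<zero>"
  have "(transvection R n i j c \<otimes>\<^bsub>mat_monoid R n\<^esub> M) $$ (k, l) =
      (\<Oplus>m\<in>{..<n}. transvection R n i j c $$ (k, m) \<otimes> M $$ (m, l))"
    using kl by (simp add: mat_monoid_mult)
  also have "\<dots> = (\<Oplus>m\<in>{..<n}. ?f m \<oplus> ?g m)"
    using assms kl M by (intro finsum_cong') (auto simp: transvection_def l_distr)
  also have "\<dots> = (\<Oplus>m\<in>{..<n}. ?f m) \<oplus> (\<Oplus>m\<in>{..<n}. ?g m)"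
    using assms M kl by (intro finsum_addf) auto
  also have "(\<Oplus>m\<in>{..<n}. ?f m) = M $$ (k, l)"
    using kl M by (intro finsum_singleton) auto
  also have "(\<Oplus>m\<in>{..<n}. ?g m) = (if k = i then c \<otimes> M $$ (j, l) else \<zero>)"
    using assms kl M by (intro finsum_singleton) auto
  finally show "(transvection R n i j c \<otimes>\<^bsub>mat_monoid R n\<^esub> M) $$ (k, l) =
      mat n n (\<lambda>(k, l). M $$ (k, l) \<oplus> (if k = i then c \<otimes> M $$ (j, l) else \<zero>)) $$ (k, l)"
    using kl by simp
qed (simp_all add: mat_monoid_mult)

lemma transvection_add:
  assumes "i < n" "j < n" "i \<noteq> j" "a \<in> carrier R" "b \<in> carrier R"
  shows "transvection R n i j a \<otimes>\<^bsub>mat_monoid R n\<^esub> transvection R n i j b =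
    transvection R n i j (a \<oplus> b)"
  using assms by (simp add: transvection_mult_left transvection_closed)
    (rule eq_matI, auto simp: transvection_def a_ac)

lemma transvection_commute:
  assumes "i < n" "j < n" "i \<noteq> j" "k < n" "l < n" "k \<noteq> l" "j \<noteq> k" "i \<noteq> l"
    and "a \<in> carrier R" "b \<in> carrier R"
  shows "transvection R n i j a \<otimes>\<^bsub>mat_monoid R n\<^esub> transvection R n k l b =
    transvection R n k l b \<otimes>\<^bsub>mat_monoid R n\<^esub> transvection R n i j a"
  using assms by (simp add: transvection_mult_left transvection_closed)
    (rule eq_matI, auto simp: transvection_def a_ac)

lemma transvection_mult:
  assumes "i < n" "j < n" "k < n" "i \<noteq> j" "j \<noteq> k" "i \<noteq> k" "a \<in> carrier R" "b \<in> carrier R"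
  shows "transvection R n i j a \<otimes>\<^bsub>mat_monoid R n\<^esub> transvection R n j k b =
    transvection R n i k (a \<otimes> b) \<otimes>\<^bsub>mat_monoid R n\<^esub> transvection R n j k b
      \<otimes>\<^bsub>mat_monoid R n\<^esub> transvection R n i j a"
proof -
  interpret M: monoid "mat_monoid R n" by (rule mat_monoid)
  \<comment> \<open>Bracketing to the right lets every factor but the last act as a row operation;
    associativity restores the stated bracketing at the end.\<close>
  let ?N = "transvection R n j k b \<otimes>\<^bsub>mat_monoid R n\<^esub> transvection R n i j a"
  have N: "?N \<in> carrier (mat_monoid R n)" using assms by (simp add: transvection_closed)
  have "transvection R n i k (a \<otimes> b) \<otimes>\<^bsub>mat_monoid R n\<^esub> ?N =
      mat n n (\<lambda>(p, l). ?N $$ (p, l) \<oplus> (if p = i then a \<otimes> b \<otimes> ?N $$ (k, l) else \<zero>))"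
    using assms by (intro transvection_mult_left N) auto
  also have "\<dots> = transvection R n i j a \<otimes>\<^bsub>mat_monoid R n\<^esub> transvection R n j k b"
    using assms
    unfolding transvection_mult_left[OF assms(2,3,8) transvection_closed[OF assms(7)]]
      transvection_mult_left[OF assms(1,2,7) transvection_closed[OF assms(8)]]
    by (intro eq_matI) (auto simp: transvection_def a_ac)
  finally have "transvection R n i k (a \<otimes> b) \<otimes>\<^bsub>mat_monoid R n\<^esub> ?N =
      transvection R n i j a \<otimes>\<^bsub>mat_monoid R n\<^esub> transvection R n j k b" .
  then show ?thesis using assms by (simp add: M.m_assoc transvection_closed)
qed

lemma transvection_zero: "transvection R n i j \<zero> = \<one>\<^bsub>mat_monoid R n\<^esub>"
  unfolding transvection_def mat_monoid_one by (rule eq_matI) auto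

lemma transvection_in_GL:
  assumes "i < n" "j < n" "i \<noteq> j" "a \<in> carrier R"
  shows "transvection R n i j a \<in> carrier (GL R n)"
proof -
  have "transvection R n i j a \<otimes>\<^bsub>mat_monoid R n\<^esub> transvection R n i j (\<ominus> a) = \<one>\<^bsub>mat_monoid R n\<^esub>"
    "transvection R n i j (\<ominus> a) \<otimes>\<^bsub>mat_monoid R n\<^esub> transvection R n i j a = \<one>\<^bsub>mat_monoid R n\<^esub>"
    using assms by (simp_all add: transvection_add transvection_zero r_neg l_neg)
  then show ?thesis
    unfolding GL_def units_of_carrier Units_def
    using transvection_closed[OF assms(4)] transvection_closed[OF a_inv_closed[OF assms(4)]] by blast
qed

lemma steinberg_transvection:
  assumes "n \<ge> 3"
  shows "steinberg (GL R n) R n (transvection R n)"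
proof -
  interpret M: monoid "mat_monoid R n" by (rule mat_monoid)
  interpret group "GL R n" unfolding GL_def by (rule M.units_group)
  have mult: "x \<otimes>\<^bsub>GL R n\<^esub> y = x \<otimes>\<^bsub>mat_monoid R n\<^esub> y" for x y
    by (simp add: GL_def units_of_mult)
  show ?thesis
    by unfold_locales
      (simp_all add: assms mult transvection_in_GL transvection_add transvection_commute
        transvection_mult)
qed

end

theorem lemma7:
  fixes R :: "('a, 'b) ring_scheme" and n :: nat and A B C :: "'a set"
  assumes "ring R"
    and "n \<ge> 3"
    and "ideal A R" and "ideal B R" and "ideal C R"
  shows "mixed_commutator (GL R n)
           (mixed_commutator (GL R n) (elementary R n A) (elementary R n B))
           (elementary R n C)
       = mixed_commutator (GL R n)
           (elementary R n (sym_ideal_prod R A B))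
           (elementary R n C)"
proof -
  interpret steinberg "GL R n" R n "transvection R n"
    using assms by (intro ring.steinberg_transvection)
  have "elementary R n X = El X" for X
    by (simp add: elementary_def El_def)
  then show ?thesis using double_commutator[OF assms(3-5)] by simp
qed

end
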